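(* For every fixed integer $k>0$ and every sufficiently large $n$ there exists a $(2k+1)$-locally plane geometric graph on $n$ vertices having at least $\left(\frac{\log^{(k)} n}{240^k}-k\right)n$ edges. Moreover, given two arbitrary disks in the plane, one can further assume that every edge of this geometric graph connects a vertex lying inside one of the disks to a vertex lying inside the other disk.
   Context: A geometric graph is a straight-line drawing of a simple finite graph in the plane: vertices are distinct points, each edge $xy$ is the straight segment between $x$ and $y$, and no edge passes through a vertex other than its two endpoints. Two edges cross if the segments have a common interior point. A subgraph is self-intersecting if it contains a pair of crossing edges. For $k\ge 3$, a geometric graph is $k$-locally plane if it has no self-intersecting subgraph whose underlying abstract graph is isomorphic to a path of length at most $k$. Here $\log$ is the binary logarithm and $\log^{(k)}$ denotes the $k$ times iterated logarithm. *)

theory Defs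
  imports "HOL-Analysis.Analysis"
begin

definition simple_graph :: "'a set \<Rightarrow> 'a set set \<Rightarrow> bool" where
  "simple_graph V E \<longleftrightarrow> finite V \<and> (\<forall>e\<in>E. e \<subseteq> V \<and> card e = 2)"

definition subgraph :: "'a set \<Rightarrow> 'a set set \<Rightarrow> 'a set \<Rightarrow> 'a set set \<Rightarrow> bool" where
  "subgraph V' E' V E \<longleftrightarrow> simple_graph V' E' \<and> V' \<subseteq> V \<and> E' \<subseteq> E"

definition graph_isomorphic :: "'a set \<Rightarrow> 'a set set \<Rightarrow> 'b set \<Rightarrow> 'b set set \<Rightarrow> bool" where
  "graph_isomorphic V E W F \<longleftrightarrow> (\<exists>f. bij_betw f V W \<and> (\<lambda>e. f ` e) ` E = F)"

text \<open>The path of length \<open>m\<close> (\<open>m\<close> edges, \<open>m + 1\<close> vertices) is the graph with vertex set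
  \<open>{0..m}\<close> and the following edges.\<close>

definition path_edges :: "nat \<Rightarrow> nat set set" where
  "path_edges m = {{i, Suc i} | i. i < m}"

definition geometric_graph :: "(real^2) set \<Rightarrow> (real^2) set set \<Rightarrow> bool" where
  "geometric_graph V E \<longleftrightarrow> simple_graph V E \<and>
     (\<forall>x y v. {x, y} \<in> E \<longrightarrow> v \<in> V \<longrightarrow> v \<in> closed_segment x y \<longrightarrow> v = x \<or> v = y)"

text \<open>An interior point of an edge is a point of the segment other than its two endpoints.\<close>

definition crossing :: "(real^2) set \<Rightarrow> (real^2) set \<Rightarrow> bool" where
  "crossing e e' \<longleftrightarrow> e \<noteq> e' \<and>
     (\<exists>x y u v. e = {x, y} \<and> e' = {u, v} \<and> open_segment x y \<inter> open_segment u v \<noteq> {})"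

definition self_intersecting :: "(real^2) set set \<Rightarrow> bool" where
  "self_intersecting E \<longleftrightarrow> (\<exists>e\<in>E. \<exists>e'\<in>E. crossing e e')"

definition locally_plane :: "nat \<Rightarrow> (real^2) set \<Rightarrow> (real^2) set set \<Rightarrow> bool" where
  "locally_plane l V E \<longleftrightarrow>
     \<not> (\<exists>V' E' m. subgraph V' E' V E \<and> m \<le> l \<and>
          graph_isomorphic V' E' {0..m} (path_edges m) \<and> self_intersecting E')"

end

theory Submission
  imports Defs
begin

text \<open>Start from a bipartite graph \<open>E\<close> with properly coloured edges, colours in \<open>{..<D}\<close>, and replace
  every vertex by \<open>2\<^sup>D\<close> copies indexed by bit strings; an edge of colour \<open>c\<close> joins copies whose
  strings differ in bit \<open>c\<close> only, with a prescribed direction. Along a walk the position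
  relative to the start is governed by the largest colour met. This is used in two ways.

  In the plane, let bit \<open>i\<close> move a point by \<open>(\<alpha> i, \<beta> i)\<close>, where the \<open>\<alpha> i\<close>, the \<open>\<beta> i\<close> and the slopes
  \<open>\<beta> i / \<alpha> i\<close> increase so fast that a step of colour \<open>m\<close> is steeper than every edge of
  colour at most \<open>m\<close> and flatter than every edge of larger colour. Then the end edges of a walk of length
  at most \<open>2 k + 1\<close> can cross only if the walk is a pincer: both end colours exceed all inner
  colours, and the largest inner colour sits at a position of a certain parity.

  Pincers are excluded by iterating the same replacement combinatorially. The edges of the new graph
  are coloured by the pairs of strings at their ends, ordered lexicographically with the string on one
  fixed side first. A forbidden pattern of length \<open>2 k + 2\<close> in the new colours forces a forbidden pattern
  of length at most \<open>2 k\<close> in the old ones. Each replacement keeps the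
  ratio of edges to vertices up to a factor \<open>1/2\<close> but makes the number of vertices and colours
  exponential, so the density after the last one is of order \<open>log\<^sup>(\<^sup>k\<^sup>) n\<close>.\<close>

section \<open>Alternating walks\<close>

text \<open>The walk starts on the left if \<open>b\<close> is even and on the right if \<open>b\<close> is odd; shifting and
  reversing walks only change \<open>b\<close>.\<close>

definition walk :: "('a \<times> 'a \<times> nat) set \<Rightarrow> nat \<Rightarrow> nat \<Rightarrow> (nat \<Rightarrow> 'a) \<Rightarrow> (nat \<Rightarrow> nat) \<Rightarrow> bool" where
  "walk E b L v c \<longleftrightarrow>
     (\<forall>n<L. if even (n + b) then (v n, v (Suc n), c n) \<in> E else (v (Suc n), v n, c n) \<in> E) \<and>
     (\<forall>n. Suc n < L \<longrightarrow> c n \<noteq> c (Suc n))"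

text \<open>Bit strings are read as numbers. The parity conditions exclude carries, so a step with
  \<open>n + b\<close> even just sets bit \<open>c n\<close> and every other step just clears
  it.\<close>

definition flips :: "nat \<Rightarrow> nat \<Rightarrow> (nat \<Rightarrow> nat) \<Rightarrow> (nat \<Rightarrow> nat) \<Rightarrow> bool" where
  "flips b L x c \<longleftrightarrow>
     (\<forall>n<L. if even (n + b) then x (Suc n) = x n + 2 ^ c n \<and> even (x n div 2 ^ c n)
             else x n = x (Suc n) + 2 ^ c n \<and> even (x (Suc n) div 2 ^ c n))"

text \<open>The strings agree above bit \<open>m\<close>, which is clear in \<open>x\<close> and set
  in \<open>y\<close>; the bits below \<open>m\<close> are arbitrary.\<close>

definition rises :: "nat \<Rightarrow> nat \<Rightarrow> nat \<Rightarrow> bool" where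
  "rises m x y \<longleftrightarrow> y div 2 ^ m = x div 2 ^ m + 1 \<and> even (x div 2 ^ m)"

lemma rises_less: "rises m x y \<Longrightarrow> x < y"
  unfolding rises_def by (metis div_le_mono less_add_one not_le)

lemma walk_parity: "even b = even b' \<Longrightarrow> walk E b L v c = walk E b' L v c"
  unfolding walk_def by simp

lemma walk_shift:
  assumes "walk E b L v c" "a + L' \<le> L"
  shows "walk E (a + b) L' (\<lambda>n. v (a + n)) (\<lambda>n. c (a + n))"
proof -
  have "if even (n + (a + b)) then (v (a + n), v (a + Suc n), c (a + n)) \<in> E
      else (v (a + Suc n), v (a + n), c (a + n)) \<in> E" if "n < L'" for n
  proof -
    have "n + (a + b) = a + n + b" "a + n < L" using assms(2) that by auto
    then show ?thesis using assms(1) unfolding walk_def by (metis add_Suc_right)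
  qed
  moreover have "c (a + n) \<noteq> c (a + Suc n)" if "Suc n < L'" for n
    using assms that unfolding walk_def by simp
  ultimately show ?thesis unfolding walk_def by blast
qed

lemma no_carry:
  fixes y :: nat
  assumes "even (y div 2 ^ c)" "c < M"
  shows "(y + 2 ^ c) div 2 ^ M = y div 2 ^ M"
proof -
  obtain t where M: "M = Suc c + t"
    using assms(2) less_iff_Suc_add by auto
  have "(y + 2 ^ c) div 2 ^ Suc c = (y div 2 ^ c + 1) div 2"
    by (simp add: div_mult2_eq power_Suc2 del: power_Suc)
  also have "\<dots> = y div 2 ^ c div 2"
    using assms(1) by (auto elim!: evenE)
  also have "\<dots> = y div 2 ^ Suc c"
    by (simp add: div_mult2_eq power_Suc2 del: power_Suc)
  finally show ?thesis
    unfolding M power_add div_mult2_eq by simp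
qed

lemma walk_neq: "walk E b L v c \<Longrightarrow> Suc n < L \<Longrightarrow> c n \<noteq> c (Suc n)"
  unfolding walk_def by blast

lemma flips_upD: "flips b L x c \<Longrightarrow> n < L \<Longrightarrow> even (n + b) \<Longrightarrow> x (Suc n) = x n + 2 ^ c n"
  and flips_downD: "flips b L x c \<Longrightarrow> n < L \<Longrightarrow> odd (n + b) \<Longrightarrow> x n = x (Suc n) + 2 ^ c n"
  unfolding flips_def by auto

lemma flips_step:
  assumes "flips b L x c" "n < L" "c n < M"
  shows "x (Suc n) div 2 ^ M = x n div 2 ^ M"
  using assms no_carry[of _ "c n" M] unfolding flips_def by metis

lemma flips_const:
  assumes "flips b L x c" "a \<le> e" "e \<le> L" "\<And>n. a \<le> n \<Longrightarrow> n < e \<Longrightarrow> c n < M"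
  shows "x e div 2 ^ M = x a div 2 ^ M"
  using assms(2,3,4)
proof (induction e rule: dec_induct)
  case (step n)
  then show ?case using flips_step[OF assms(1), of n M] by simp
qed simp

text \<open>Smaller colours leave the bits from \<open>c \<mu>\<close> upwards alone, so on these
  only step \<open>\<mu>\<close> acts, and it sets a bit. \<open>flips_down\<close> is the mirror
  image.\<close>

lemma flips_up:
  assumes f: "flips b L x c" and "even (\<mu> + b)" "a \<le> \<mu>" "\<mu> < e" "e \<le> L"
    and less: "\<And>n. a \<le> n \<Longrightarrow> n < e \<Longrightarrow> n \<noteq> \<mu> \<Longrightarrow> c n < c \<mu>"
  shows "rises (c \<mu>) (x a) (x e)"
proof -
  have "x \<mu> div 2 ^ c \<mu> = x a div 2 ^ c \<mu>" "x e div 2 ^ c \<mu> = x (Suc \<mu>) div 2 ^ c \<mu>"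
    using assms by (auto intro!: flips_const[OF f])
  moreover have "x (Suc \<mu>) = x \<mu> + 2 ^ c \<mu>" "even (x \<mu> div 2 ^ c \<mu>)"
    using f assms(2,4,5) unfolding flips_def by auto
  ultimately show ?thesis unfolding rises_def by auto
qed

lemma flips_down:
  assumes f: "flips b L x c" and "odd (\<mu> + b)" "a \<le> \<mu>" "\<mu> < e" "e \<le> L"
    and less: "\<And>n. a \<le> n \<Longrightarrow> n < e \<Longrightarrow> n \<noteq> \<mu> \<Longrightarrow> c n < c \<mu>"
  shows "rises (c \<mu>) (x e) (x a)"
proof -
  have "x \<mu> div 2 ^ c \<mu> = x a div 2 ^ c \<mu>" "x e div 2 ^ c \<mu> = x (Suc \<mu>) div 2 ^ c \<mu>"
    using assms by (auto intro!: flips_const[OF f])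
  moreover have "x \<mu> = x (Suc \<mu>) + 2 ^ c \<mu>" "even (x (Suc \<mu>) div 2 ^ c \<mu>)"
    using f assms(2,4,5) unfolding flips_def by auto
  ultimately show ?thesis unfolding rises_def by auto
qed

lemma argmax_interval:
  fixes c :: "nat \<Rightarrow> nat"
  assumes "a < e"
  obtains \<mu> where "a \<le> \<mu>" "\<mu> < e" "\<And>n. a \<le> n \<Longrightarrow> n < e \<Longrightarrow> c n \<le> c \<mu>"
proof -
  have "finite (c ` {a..<e})" "c ` {a..<e} \<noteq> {}" using assms by auto
  from Max_in[OF this] obtain \<mu> where "\<mu> \<in> {a..<e}" "c \<mu> = Max (c ` {a..<e})" by force
  then show thesis using that[of \<mu>] Max_ge[of "c ` {a..<e}"] by simp
qed

definition distinct_runs :: "nat \<Rightarrow> ('a \<times> 'a \<times> nat) set \<Rightarrow> bool" where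
  "distinct_runs k E \<longleftrightarrow> (\<forall>b L v c. L \<le> 2 * k \<longrightarrow> walk E b L v c \<longrightarrow> inj_on c {..<L})"

lemma distinct_runsD:
  assumes "distinct_runs k E" "walk E b L v c" "i < j" "j < L" "j < i + 2 * k"
  shows "c i \<noteq> c j"
proof -
  have "inj_on (\<lambda>n. c (i + n)) {..<Suc (j - i)}"
    using assms walk_shift[OF assms(2), of i "Suc (j - i)"] unfolding distinct_runs_def
    by (metis (no_types, lifting) Suc_leI add_Suc_right le_add_diff_inverse less_imp_le_nat
        less_diff_conv2 add.commute)
  then show ?thesis
    using assms(3) by (auto dest!: inj_onD[of _ _ 0 "j - i"])
qed

text \<open>The largest colour of the window occurs in it only once, so its bit differs at the two
  ends.\<close>

lemma flips_neq:
  assumes "flips b L x c" "walk E b' L v c" "distinct_runs k E" "a < e" "e \<le> L" "e \<le> a + 2 * k"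
  shows "x a \<noteq> x e"
proof -
  obtain \<mu> where mu: "a \<le> \<mu>" "\<mu> < e" "\<And>n. a \<le> n \<Longrightarrow> n < e \<Longrightarrow> c n \<le> c \<mu>"
    using argmax_interval[OF assms(4)] by blast
  have "c n < c \<mu>" if "a \<le> n" "n < e" "n \<noteq> \<mu>" for n
  proof -
    have "c n \<noteq> c \<mu>"
      using distinct_runsD[OF assms(3,2), of n \<mu>] distinct_runsD[OF assms(3,2), of \<mu> n] that mu assms
      by (cases "n < \<mu>") auto
    then show ?thesis using mu(3) that by (simp add: le_neq_implies_less)
  qed
  then show ?thesis
    using flips_up[OF assms(1) _ mu(1,2) assms(5)] flips_down[OF assms(1) _ mu(1,2) assms(5)]
    by (metis rises_less less_irrefl)
qed

text \<open>Let \<open>M\<close> be the largest colour and \<open>m\<close> its last occurrence. If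
  step \<open>m\<close> went up, then \<open>x (2 * i) \<le> x 0\<close> would force bit
  \<open>M\<close> to be set in \<open>x 0\<close> and cleared by an occurrence of \<open>M\<close>
  too close to \<open>m\<close>. So \<open>m = 2 * V + 1\<close> goes down, and bit \<open>M\<close>
  makes \<open>x (2 * V)\<close> the larger number.\<close>

lemma last_top_step:
  assumes f: "flips 0 (2 * i) x c" and w: "walk E b (2 * i) v c" and d: "distinct_runs k E"
    and i: "0 < i" "i \<le> Suc k" and le: "x (2 * i) \<le> x 0"
  obtains V where "V < i" "\<And>n. 2 * V + 1 < n \<Longrightarrow> n < 2 * i \<Longrightarrow> c n < c (2 * V + 1)"
    "x (2 * i) < x (2 * V)"
proof -
  obtain \<mu> where mu: "\<mu> < 2 * i" "\<And>n. n < 2 * i \<Longrightarrow> c n \<le> c \<mu>"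
    using argmax_interval[of 0 "2 * i" c] i by auto
  define M where "M = c \<mu>"
  define m where "m = Max {n. n < 2 * i \<and> c n = M}"
  have "m \<in> {n. n < 2 * i \<and> c n = M}"
    unfolding m_def by (rule Max_in) (use mu M_def in auto)
  then have m: "m < 2 * i" "c m = M" by auto
  have later: "c n < M" if "m < n" "n < 2 * i" for n
  proof -
    have "c n \<noteq> M"
    proof
      assume "c n = M"
      then have "n \<le> m" unfolding m_def using that by (intro Max_ge) auto
      then show False using that by simp
    qed
    then show ?thesis using mu(2)[OF that(2)] M_def by simp
  qed
  have const: "x (2 * i) div 2 ^ M = x (Suc m) div 2 ^ M"
    using flips_const[OF f, of "Suc m" "2 * i" M] m later by auto
  have const2: "x e div 2 ^ Suc M = x 0 div 2 ^ Suc M" if "e \<le> 2 * i" for e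
    using flips_const[OF f, of 0 e "Suc M"] that mu M_def by (simp add: less_Suc_eq_le)
  have step: "if even m then x (Suc m) = x m + 2 ^ M \<and> even (x m div 2 ^ M)
             else x m = x (Suc m) + 2 ^ M \<and> even (x (Suc m) div 2 ^ M)"
    using f m unfolding flips_def by auto
  have "odd m"
  proof
    assume "even m"
    with step const have top: "odd (x (2 * i) div 2 ^ M)" and ev: "even (x m div 2 ^ M)" by auto
    have "x (2 * i) div 2 ^ M div 2 = x 0 div 2 ^ M div 2"
      using const2[of "2 * i"] by (simp add: div_mult2_eq power_Suc2 del: power_Suc)
    moreover have "x (2 * i) div 2 ^ M \<le> x 0 div 2 ^ M" using le by (rule div_le_mono)
    moreover have "odd r" if "p div 2 = r div 2" "p \<le> r" "odd p" for p r :: nat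
      using that by presburger
    ultimately have od: "odd (x 0 div 2 ^ M)" using top by blast
    have "\<exists>n<m. c n = M"
    proof (rule ccontr)
      assume "\<not> ?thesis"
      then have "x m div 2 ^ M = x 0 div 2 ^ M"
        using flips_const[OF f, of 0 m M] m mu M_def by (metis le0 le_neq_implies_less less_imp_le_nat less_trans)
      with ev od show False by simp
    qed
    then obtain n where n: "n < m" "c n = M" by blast
    \<comment> \<open>Step 0 goes up and needs its bit clear in \<open>x 0\<close>. With
      \<open>n = 0\<close> excluded, \<open>n\<close> and \<open>m\<close> are less than
      \<open>2 * k\<close> apart even if \<open>i = Suc k\<close>.\<close>
    have "n \<noteq> 0"
      using f od n m unfolding flips_def by (metis add.right_neutral dvd_0_right less_trans)
    moreover have "m \<le> 2 * i - 2" using \<open>even m\<close> m(1) by presburger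
    ultimately have "m < n + 2 * k" using i by linarith
    then show False using distinct_runsD[OF d w n(1) m(1)] n m by simp
  qed
  then obtain V where V: "m = 2 * V + 1" by (auto elim: oddE)
  have "c (2 * V) \<noteq> M" using w V m unfolding walk_def by auto
  then have "c (2 * V) < M" using mu(2)[of "2 * V"] m V M_def by simp
  then have "x (2 * V) div 2 ^ M = x m div 2 ^ M"
    using flips_step[OF f, of "2 * V" M] m V by simp
  also have "\<dots> = x (2 * i) div 2 ^ M + 1"
    using step \<open>odd m\<close> const by simp
  finally have "x (2 * i) < x (2 * V)" by (metis div_le_mono less_add_one not_le)
  then show thesis using that[of V] V m later by auto
qed

section \<open>Forbidden colour patterns\<close>

text \<open>Two forbidden patterns: \<open>pincers\<close> is the one which matters for crossings, while \<open>ascents\<close> is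
  the one which reproduces itself under lifting with \<open>desc\<close>.\<close>

definition ascents :: "(nat \<Rightarrow> nat) \<Rightarrow> nat \<Rightarrow> bool" where
  "ascents c i \<longleftrightarrow>
     (\<forall>n. 0 < n \<longrightarrow> n < 2 * i \<longrightarrow> c n < c 0) \<and> c (2 * i - 2) < c (2 * i - 1) \<and>
     (\<forall>l. 1 \<le> l \<longrightarrow> l < i \<longrightarrow>
        (\<exists>\<mu>. odd \<mu> \<and> 2 * l - 1 \<le> \<mu> \<and> \<mu> \<le> 2 * i - 2 \<and>
           (\<forall>n. 2 * l - 1 \<le> n \<longrightarrow> n \<le> 2 * i - 2 \<longrightarrow> c n \<le> c \<mu>)))"

text \<open>Only walks that start on the left count here; \<open>pincer_free\<close> covers both
  kinds of start.\<close>

definition ascent_free :: "nat \<Rightarrow> ('a \<times> 'a \<times> nat) set \<Rightarrow> bool" where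
  "ascent_free k E \<longleftrightarrow> (\<forall>i v c. 1 \<le> i \<longrightarrow> i \<le> k \<longrightarrow> walk E 0 (2 * i) v c \<longrightarrow> \<not> ascents c i)"

definition pincers :: "(nat \<Rightarrow> nat) \<Rightarrow> nat \<Rightarrow> bool" where
  "pincers c L \<longleftrightarrow> even L \<and> c (L - 1) < c 0 \<and>
     (\<exists>\<mu>. even \<mu> \<and> 0 < \<mu> \<and> \<mu> < L - 1 \<and> c \<mu> < c (L - 1) \<and> (\<forall>n. 0 < n \<longrightarrow> n < L - 1 \<longrightarrow> c n \<le> c \<mu>))"

definition pincer_free :: "nat \<Rightarrow> ('a \<times> 'a \<times> nat) set \<Rightarrow> bool" where
  "pincer_free k E \<longleftrightarrow> (\<forall>b L v c. L \<le> 2 * k \<longrightarrow> walk E b L v c \<longrightarrow> \<not> pincers c L)"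

text \<open>Common core of the two lifting arguments: the steps \<open>2 * V + 1\<close> to
  \<open>2 * u\<close> show an \<open>ascents\<close> pattern in the old colours. Its third clause
  comes from \<open>high\<close>: if the largest colour between \<open>2 * (V + l)\<close> and
  \<open>2 * u\<close> belonged to a downward step, then \<open>x (2 * (V + l))\<close> would exceed
  \<open>x (2 * u)\<close>.\<close>

lemma ascents_below:
  assumes f: "flips 0 L x c" and w: "walk E (Suc 0) L v c" and d: "distinct_runs k E"
    and free: "ascent_free k E"
    and V: "V < u" "2 * u < L" "u \<le> V + k"
    and top: "\<And>n. 2 * V + 1 < n \<Longrightarrow> n \<le> 2 * u \<Longrightarrow> c n < c (2 * V + 1)"
    and up: "c (2 * u - 1) < c (2 * u)"
    and high: "\<And>l. V < l \<Longrightarrow> l < u \<Longrightarrow> x (2 * l) \<le> x (2 * u)"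
  shows False
proof -
  define i where "i = u - V"
  define s where "s n = c (2 * V + 1 + n)" for n
  have i: "1 \<le> i" "i \<le> k" "u = V + i" using V i_def by auto
  have "walk E (2 * V + 1 + Suc 0) (2 * i) (\<lambda>n. v (2 * V + 1 + n)) s"
    unfolding s_def using V i by (intro walk_shift[OF w]) auto
  \<comment> \<open>The given walk starts on the right; a shift by an odd number makes it start on
    the left.\<close>
  then have ws: "walk E 0 (2 * i) (\<lambda>n. v (2 * V + 1 + n)) s"
    using walk_parity[of "2 * V + 1 + Suc 0" 0 E] by simp
  have "ascents s i"
    unfolding ascents_def
  proof (intro conjI allI impI)
    fix n assume "0 < n" "n < 2 * i"
    then show "s n < s 0" unfolding s_def using top[of "2 * V + 1 + n"] i by simp
  next
    show "s (2 * i - 2) < s (2 * i - 1)"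
      using up i unfolding s_def by (cases i) auto
  next
    fix l assume l: "1 \<le> l" "l < i"
    obtain \<mu> where mu: "2 * (V + l) \<le> \<mu>" "\<mu> < 2 * u"
      "\<And>n. 2 * (V + l) \<le> n \<Longrightarrow> n < 2 * u \<Longrightarrow> c n \<le> c \<mu>"
      using argmax_interval[of "2 * (V + l)" "2 * u" c] l i by auto
    have lt: "c n < c \<mu>" if "2 * (V + l) \<le> n" "n < 2 * u" "n \<noteq> \<mu>" for n
    proof -
      have "c n \<noteq> c \<mu>"
        using distinct_runsD[OF d w, of n \<mu>] distinct_runsD[OF d w, of \<mu> n] that mu V i
        by (cases "n < \<mu>") auto
      then show ?thesis using mu(3) that by (simp add: le_neq_implies_less)
    qed
    have "even \<mu>"
    proof (rule ccontr)
      assume "odd \<mu>"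
      then have "rises (c \<mu>) (x (2 * u)) (x (2 * (V + l)))"
        using flips_down[OF f _ mu(1,2)] V lt by simp
      then show False using rises_less high[of "V + l"] l i by fastforce
    qed
    then show "\<exists>\<mu>. odd \<mu> \<and> 2 * l - 1 \<le> \<mu> \<and> \<mu> \<le> 2 * i - 2 \<and>
        (\<forall>n. 2 * l - 1 \<le> n \<longrightarrow> n \<le> 2 * i - 2 \<longrightarrow> s n \<le> s \<mu>)"
      using mu l i unfolding s_def
      by (intro exI[of _ "\<mu> - (2 * V + 1)"]) auto
  qed
  then show False using free ws i unfolding ascent_free_def by blast
qed

section \<open>Lifting\<close>

text \<open>The two sides are exchanged: right vertices of \<open>E\<close> give left vertices of the lift. The argument
  for \<open>ascents\<close> needs this alternation.\<close>

definition lift :: "(nat \<Rightarrow> nat \<Rightarrow> nat) \<Rightarrow> nat \<Rightarrow> (nat list \<times> nat list \<times> nat) set \<Rightarrow>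
    (nat list \<times> nat list \<times> nat) set" where
  "lift col D E = {(y # r, (y + 2 ^ c) # l, col y (y + 2 ^ c)) | l r c y.
     (l, r, c) \<in> E \<and> y < 2 ^ D \<and> even (y div 2 ^ c)}"

lemma flip_bound:
  assumes "y < 2 ^ D" "even (y div 2 ^ c)" "c < D"
  shows "y + 2 ^ c < (2::nat) ^ D"
proof -
  have "(y + 2 ^ c) div 2 ^ D = y div 2 ^ D" using assms no_carry by blast
  then show ?thesis using assms(1) by (simp add: div_eq_0_iff)
qed

text \<open>This is what \<open>asc\<close> and \<open>desc\<close> share: the first string is the
  major key and the colour determines both strings, while ties may be broken either way.\<close>

definition major_first :: "nat \<Rightarrow> (nat \<Rightarrow> nat \<Rightarrow> nat) \<Rightarrow> bool" where
  "major_first D col \<longleftrightarrow> (\<forall>p q p' q'. p < 2 ^ D \<longrightarrow> q < 2 ^ D \<longrightarrow> p' < 2 ^ D \<longrightarrow> q' < 2 ^ D \<longrightarrow>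
     (col p q \<le> col p' q' \<longrightarrow> p \<le> p') \<and> (col p q = col p' q' \<longrightarrow> p = p' \<and> q = q') \<and> col p q < 4 ^ D)"

text \<open>Taking tails projects the walk to \<open>E\<close> with the sides exchanged, hence
  \<open>Suc b\<close>, and the heads follow the old colours \<open>\<tau>\<close>. Two equal
  consecutive old colours would bring the head back, so both new edges would have the same pair of
  strings and thus the same new colour.\<close>

lemma lift_walk:
  assumes w: "walk (lift col D E) b L v c" and D: "\<forall>l r c. (l, r, c) \<in> E \<longrightarrow> c < D"
  obtains \<tau> where "walk E (Suc b) L (\<lambda>n. tl (v n)) \<tau>" "flips b L (\<lambda>n. hd (v n)) \<tau>"
    "\<And>n. n < L \<Longrightarrow> hd (v n) < 2 ^ D \<and> hd (v (Suc n)) < 2 ^ D"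
    "\<And>n. n < L \<Longrightarrow> c n = (if even (n + b) then col (hd (v n)) (hd (v (Suc n)))
                                else col (hd (v (Suc n))) (hd (v n)))"
proof -
  have "\<forall>n. \<exists>t. n < L \<longrightarrow>
      (if even (n + b) then \<exists>l r y. v n = y # r \<and> v (Suc n) = (y + 2 ^ t) # l \<and> (l, r, t) \<in> E \<and>
          y < 2 ^ D \<and> even (y div 2 ^ t) \<and> c n = col y (y + 2 ^ t)
       else \<exists>l r y. v (Suc n) = y # r \<and> v n = (y + 2 ^ t) # l \<and> (l, r, t) \<in> E \<and>
          y < 2 ^ D \<and> even (y div 2 ^ t) \<and> c n = col y (y + 2 ^ t))"
    using w unfolding walk_def lift_def by (auto split: if_splits)
  then obtain \<tau> where t: "\<And>n. n < L \<Longrightarrow>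
      (if even (n + b) then \<exists>l r y. v n = y # r \<and> v (Suc n) = (y + 2 ^ \<tau> n) # l \<and> (l, r, \<tau> n) \<in> E \<and>
          y < 2 ^ D \<and> even (y div 2 ^ \<tau> n) \<and> c n = col y (y + 2 ^ \<tau> n)
       else \<exists>l r y. v (Suc n) = y # r \<and> v n = (y + 2 ^ \<tau> n) # l \<and> (l, r, \<tau> n) \<in> E \<and>
          y < 2 ^ D \<and> even (y div 2 ^ \<tau> n) \<and> c n = col y (y + 2 ^ \<tau> n))"
    by metis
  have f: "flips b L (\<lambda>n. hd (v n)) \<tau>"
    unfolding flips_def using t by (auto split: if_splits) (fastforce+)?
  have col: "c n = (if even (n + b) then col (hd (v n)) (hd (v (Suc n)))
                                else col (hd (v (Suc n))) (hd (v n)))" if "n < L" for n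
    using t[OF that] by (auto split: if_splits)
  have bd: "hd (v n) < 2 ^ D \<and> hd (v (Suc n)) < 2 ^ D" if "n < L" for n
    using t[OF that] D flip_bound by (fastforce split: if_splits)
  have "\<tau> n \<noteq> \<tau> (Suc n)" if n: "Suc n < L" for n
  proof
    assume eq: "\<tau> n = \<tau> (Suc n)"
    have "hd (v n) = hd (v (Suc (Suc n)))"
      using f n eq unfolding flips_def by (metis Suc_lessD add_Suc even_Suc add_right_cancel)
    then have "c n = c (Suc n)" using col[of n] col[of "Suc n"] n by simp
    then show False using w n unfolding walk_def by blast
  qed
  moreover have "if even (n + Suc b) then (tl (v n), tl (v (Suc n)), \<tau> n) \<in> E
      else (tl (v (Suc n)), tl (v n), \<tau> n) \<in> E" if "n < L" for n
    using t[OF that] by (auto split: if_splits)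
  ultimately have "walk E (Suc b) L (\<lambda>n. tl (v n)) \<tau>" unfolding walk_def by blast
  then show thesis using that f col bd by blast
qed

text \<open>Equal new colours mean equal pairs of strings, so two positions at most
  \<open>2 * k\<close> steps apart would carry the same string, against
  \<open>flips_neq\<close>.\<close>

lemma distinct_runs_lift:
  assumes d: "distinct_runs k E" and D: "\<forall>l r c. (l, r, c) \<in> E \<longrightarrow> c < D"
    and col: "major_first D col"
  shows "distinct_runs (Suc k) (lift col D E)"
  unfolding distinct_runs_def
proof (intro allI impI)
  fix b L v c
  assume L: "L \<le> 2 * Suc k" and w: "walk (lift col D E) b L v c"
  from lift_walk[OF w D] obtain \<tau> where t: "walk E (Suc b) L (\<lambda>n. tl (v n)) \<tau>"
    "flips b L (\<lambda>n. hd (v n)) \<tau>"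
    "\<And>n. n < L \<Longrightarrow> hd (v n) < 2 ^ D \<and> hd (v (Suc n)) < 2 ^ D"
    "\<And>n. n < L \<Longrightarrow> c n = (if even (n + b) then col (hd (v n)) (hd (v (Suc n)))
                                else col (hd (v (Suc n))) (hd (v n)))" by blast
  have neq: "c i \<noteq> c j" if "i < j" "j < L" for i j
  proof
    assume eq: "c i = c j"
    show False
    proof (cases "even i = even j")
      case True
      then have "hd (v i) = hd (v j)"
        using eq t(3)[of i] t(3)[of j] t(4)[of i] t(4)[of j] that col unfolding major_first_def
        by (cases "even (i + b)") auto
      \<comment> \<open>An even distance below \<open>2 * k + 2\<close> is at most
        \<open>2 * k\<close>.\<close>
      moreover have "j \<le> i + 2 * k" using that L True by presburger
      ultimately show False
        using flips_neq[OF t(2,1) d, of i j] that by simp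
    next
      case False
      \<comment> \<open>The two edges are now traversed in opposite directions, so their inner ends
        lie on the same side.\<close>
      then have "hd (v (Suc i)) = hd (v j)"
        using eq t(3)[of i] t(3)[of j] t(4)[of i] t(4)[of j] that col unfolding major_first_def
        by (cases "even (i + b)") auto
      moreover have "j \<noteq> Suc i" using w eq that unfolding walk_def by blast
      ultimately show False
        using flips_neq[OF t(2,1) d, of "Suc i" j] that L by simp
    qed
  qed
  then show "inj_on c {..<L}"
    by (metis (mono_tags) inj_onI lessThan_iff linorder_neqE_nat)
qed

section \<open>Lexicographic colours and the patterns they forbid\<close>

definition asc :: "nat \<Rightarrow> nat \<Rightarrow> nat \<Rightarrow> nat" where "asc D p q = p * 2 ^ D + q"

text \<open>Ties in the first string go to the smaller second string. This suits the maxima at odd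
  positions in \<open>ascents\<close>, whereas \<open>asc\<close> suits the maximum at an even
  position in \<open>pincers\<close>.\<close>

definition desc :: "nat \<Rightarrow> nat \<Rightarrow> nat \<Rightarrow> nat" where "desc D p q = p * 2 ^ D + (2 ^ D - 1 - q)"

lemma major_first_asc: "major_first D (asc D)"
proof -
  have 1: "p \<le> p'" if "p * K + q \<le> p' * K + q'" "q' < K" for p q p' q' K :: nat
  proof (rule ccontr)
    assume "\<not> p \<le> p'"
    then have "Suc p' * K \<le> p * K" by (intro mult_le_mono1) simp
    then show False using that by simp
  qed
  have 2: "p * K + q < K * K" if "p < K" "q < K" for p q K :: nat
  proof -
    have "Suc p * K \<le> K * K" using that by (intro mult_le_mono1) simp
    then show ?thesis using that by simp
  qed
  have 3: "(4::nat) ^ D = 2 ^ D * 2 ^ D" by (simp flip: power_mult_distrib)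
  have 4: "p = p' \<and> q = q'" if "p * K + q = p' * K + q'" "q < K" "q' < K" for p q p' q' K :: nat
    using 1[of p K q p' q'] 1[of p' K q' p q] that by simp
  show ?thesis unfolding major_first_def asc_def 3
  proof (intro allI impI conjI)
    fix p q p' q' :: nat
    assume b: "p < 2 ^ D" "q < 2 ^ D" "p' < 2 ^ D" "q' < 2 ^ D"
    show "p * 2 ^ D + q < 2 ^ D * 2 ^ D" using 2 b by blast
    show "p \<le> p'" if "p * 2 ^ D + q \<le> p' * 2 ^ D + q'" using 1[OF that b(4)] .
    show "p = p'" "q = q'" if "p * 2 ^ D + q = p' * 2 ^ D + q'" using 4[OF that b(2,4)] by auto
  qed
qed

lemma major_first_desc: "major_first D (desc D)"
proof -
  have d: "desc D p q = asc D p (2 ^ D - 1 - q)" for p q unfolding desc_def asc_def ..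
  have b: "(2::nat) ^ D - 1 - q < 2 ^ D" for q
    by (simp add: less_imp_diff_less)
  have inj: "q = q'" if "(2::nat) ^ D - 1 - q = 2 ^ D - 1 - q'" "q < 2 ^ D" "q' < 2 ^ D" for q q'
    using that by linarith
  show ?thesis
    unfolding major_first_def
  proof (intro allI impI conjI)
    fix p q p' q' :: nat
    assume "p < 2 ^ D" "q < 2 ^ D" "p' < 2 ^ D" "q' < 2 ^ D"
    note b' = this(1) b[of q] this(3) b[of q'] and q = this(2,4)
    note m = major_first_asc[unfolded major_first_def, rule_format, OF b', folded d]
    show "desc D p q < 4 ^ D" using m by blast
    show "p \<le> p'" if "desc D p q \<le> desc D p' q'" using m that by blast
    show "p = p'" "q = q'" if "desc D p q = desc D p' q'" using m that inj q by blast+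
  qed
qed

text \<open>The steps \<open>2 * l - 1\<close> and \<open>2 * l\<close> share the major key
  \<open>x (2 * l)\<close>. The first two clauses of \<open>ascents\<close> thus compare
  \<open>x (2 * i)\<close> with \<open>x 0\<close> and with its predecessor on that side, so
  \<open>last_top_step\<close> yields a \<open>V\<close> below \<open>i - 1\<close>. The third
  clause then provides the \<open>u\<close> required by \<open>ascents_below\<close>.\<close>

lemma ascent_free_lift:
  assumes d: "distinct_runs k E" and free: "ascent_free k E"
    and D: "\<forall>l r c. (l, r, c) \<in> E \<longrightarrow> c < D"
  shows "ascent_free (Suc k) (lift (desc D) D E)"
  unfolding ascent_free_def
proof (intro allI impI notI)
  fix i v c
  assume i: "1 \<le> i" "i \<le> Suc k" and w: "walk (lift (desc D) D E) 0 (2 * i) v c" and a: "ascents c i"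
  from lift_walk[OF w D] obtain \<tau> where t: "walk E (Suc 0) (2 * i) (\<lambda>n. tl (v n)) \<tau>"
    "flips 0 (2 * i) (\<lambda>n. hd (v n)) \<tau>"
    "\<And>n. n < 2 * i \<Longrightarrow> hd (v n) < 2 ^ D \<and> hd (v (Suc n)) < 2 ^ D"
    "\<And>n. n < 2 * i \<Longrightarrow> c n = (if even (n + 0) then desc D (hd (v n)) (hd (v (Suc n)))
                                else desc D (hd (v (Suc n))) (hd (v n)))" by blast
  define x where "x n = hd (v n)" for n
  have xb: "x n < 2 ^ D" if "n \<le> 2 * i" for n
    using t(3)[of n] t(3)[of "n - 1"] that i unfolding x_def by (cases "n = 2 * i") auto
  have ce: "c (2 * l) = desc D (x (2 * l)) (x (2 * l + 1))" if "l < i" for l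
    using t(4)[of "2 * l"] that by (simp add: x_def)
  have co: "c (2 * l + 1) = desc D (x (2 * l + 2)) (x (2 * l + 1))" if "l < i" for l
    using t(4)[of "2 * l + 1"] that by (simp add: x_def)
  have maj: "p \<le> p'" if "desc D p q \<le> desc D p' q'" "p < 2 ^ D" "p' < 2 ^ D" "q < 2 ^ D" "q' < 2 ^ D"
    for p q p' q' using major_first_desc that unfolding major_first_def by blast
  have "c (2 * (i - 1) + 1) < c (2 * 0)"
    using a i unfolding ascents_def by (cases i) auto
  moreover have last: "c (2 * (i - 1) + 1) = desc D (x (2 * i)) (x (2 * (i - 1) + 1))"
    using co[of "i - 1"] i by (cases i) simp_all
  ultimately have "desc D (x (2 * i)) (x (2 * (i - 1) + 1)) \<le> desc D (x 0) (x 1)"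
    using ce[of 0] i by simp
  then have le0: "x (2 * i) \<le> x 0" using xb i by (auto dest!: maj)
  have "c (2 * (i - 1)) < c (2 * (i - 1) + 1)"
    using a i unfolding ascents_def by (cases i) auto
  then have "desc D (x (2 * (i - 1))) (x (2 * (i - 1) + 1)) \<le> desc D (x (2 * i)) (x (2 * (i - 1) + 1))"
    using ce[of "i - 1"] last i by simp
  then have le1: "x (2 * (i - 1)) \<le> x (2 * i)" using xb i by (auto dest!: maj)
  have f: "flips 0 (2 * i) x \<tau>" using t(2) unfolding x_def .
  obtain V where V: "V < i" "\<And>n. 2 * V + 1 < n \<Longrightarrow> n < 2 * i \<Longrightarrow> \<tau> n < \<tau> (2 * V + 1)"
    "x (2 * i) < x (2 * V)"
    using last_top_step[OF f t(1) d _ i(2) le0] i by auto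
  have Vi: "V + 1 < i" using V(1,3) le1 by (cases "V = i - 1") auto
  \<comment> \<open>The third clause with \<open>l = V + 1\<close>: the largest new colour of the
    range is on a step into some even position \<open>2 * u\<close>, whose string is therefore the
    largest.\<close>
  from a have "\<exists>\<mu>. odd \<mu> \<and> 2 * (V + 1) - 1 \<le> \<mu> \<and> \<mu> \<le> 2 * i - 2 \<and>
           (\<forall>n. 2 * (V + 1) - 1 \<le> n \<longrightarrow> n \<le> 2 * i - 2 \<longrightarrow> c n \<le> c \<mu>)"
    using Vi unfolding ascents_def by (metis le_add2)
  then obtain \<mu> where mu: "odd \<mu>" "2 * V + 1 \<le> \<mu>" "\<mu> \<le> 2 * i - 2"
    "\<And>n. 2 * V + 1 \<le> n \<Longrightarrow> n \<le> 2 * i - 2 \<Longrightarrow> c n \<le> c \<mu>" by auto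
  then obtain u' where "\<mu> = 2 * u' + 1" by (auto elim: oddE)
  define u where "u = u' + 1"
  have u: "\<mu> = 2 * (u - 1) + 1" "V < u" "u < i"
    using mu \<open>\<mu> = _\<close> u_def by auto
  have cu: "c (2 * (u - 1) + 1) = desc D (x (2 * u)) (x (2 * u - 1))"
    using co[of "u - 1"] u by (cases u) simp_all
  have high: "x (2 * l) \<le> x (2 * u)" if "V < l" "l < i" for l
  proof -
    have "c (2 * l) \<le> c (2 * (u - 1) + 1)"
      using mu(4)[of "2 * l"] that u by simp
    then show ?thesis using ce[of l] cu that u xb by (auto dest!: maj)
  qed
  \<comment> \<open>The major keys are equal, and \<open>desc\<close> reverses the comparison of the
    second keys; so the old colour increases from step \<open>2 * u - 1\<close> to step
    \<open>2 * u\<close>.\<close>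
  have "desc D (x (2 * u)) (x (2 * u + 1)) \<le> desc D (x (2 * u)) (x (2 * u - 1))"
    using mu(4)[of "2 * u"] u ce[of u] cu by simp
  then have "2 ^ D - 1 - x (2 * u + 1) \<le> 2 ^ D - 1 - x (2 * u - 1)"
    unfolding desc_def by simp
  moreover have "x (2 * u - 1) < 2 ^ D" "x (2 * u + 1) < 2 ^ D" using xb u by auto
  ultimately have "x (2 * u - 1) \<le> x (2 * u + 1)" by linarith
  moreover have "x (2 * u - 1) = x (2 * u) + 2 ^ \<tau> (2 * u - 1)" "x (2 * u + 1) = x (2 * u) + 2 ^ \<tau> (2 * u)"
    using flips_downD[OF f, of "2 * u - 1"] flips_upD[OF f, of "2 * u"] u by simp_all
  ultimately have "\<tau> (2 * u - 1) \<le> \<tau> (2 * u)" by simp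
  moreover have "\<tau> (2 * u - 1) \<noteq> \<tau> (Suc (2 * u - 1))"
    using walk_neq[OF t(1), of "2 * u - 1"] u by simp
  ultimately have "\<tau> (2 * u - 1) < \<tau> (2 * u)" using u by simp
  then show False
    using ascents_below[OF f t(1) d free u(2)] V(2) high u Vi i by auto
qed

text \<open>A walk starting on the right is excluded by its major keys alone. For one starting on
  the left the argument of \<open>ascent_free_lift\<close> applies with \<open>V = 0\<close>,
  because all inner colours lie below that of the last step.\<close>

lemma pincer_free_lift:
  assumes d: "distinct_runs k E" and free: "ascent_free k E"
    and D: "\<forall>l r c. (l, r, c) \<in> E \<longrightarrow> c < D"
  shows "pincer_free (Suc k) (lift (asc D) D E)"
  unfolding pincer_free_def
proof (intro allI impI notI)
  fix b L v c
  assume L: "L \<le> 2 * Suc k" and w: "walk (lift (asc D) D E) b L v c" and p: "pincers c L"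
  from lift_walk[OF w D] obtain \<tau> where t: "walk E (Suc b) L (\<lambda>n. tl (v n)) \<tau>"
    "flips b L (\<lambda>n. hd (v n)) \<tau>"
    "\<And>n. n < L \<Longrightarrow> hd (v n) < 2 ^ D \<and> hd (v (Suc n)) < 2 ^ D"
    "\<And>n. n < L \<Longrightarrow> c n = (if even (n + b) then asc D (hd (v n)) (hd (v (Suc n)))
                                else asc D (hd (v (Suc n))) (hd (v n)))" by blast
  obtain j where j: "L = 2 * j" using p unfolding pincers_def by (auto elim: evenE)
  obtain \<mu> where mu: "even \<mu>" "0 < \<mu>" "\<mu> < L - 1" "c \<mu> < c (L - 1)"
    "\<And>n. 0 < n \<Longrightarrow> n < L - 1 \<Longrightarrow> c n \<le> c \<mu>" and c0: "c (L - 1) < c 0"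
    using p unfolding pincers_def by blast
  have "2 \<le> \<mu>" using mu by presburger
  then have j2: "2 \<le> j" using mu j by simp
  define x where "x n = hd (v n)" for n
  have xb: "x n < 2 ^ D" if "n \<le> L" for n
    using t(3)[of n] t(3)[of "n - 1"] that j j2 unfolding x_def by (cases "n = L") auto
  have maj: "p \<le> p'" if "asc D p q \<le> asc D p' q'" "p < 2 ^ D" "p' < 2 ^ D" "q < 2 ^ D" "q' < 2 ^ D"
    for p q p' q' using major_first_asc that unfolding major_first_def by blast
  have f: "flips b L x \<tau>" using t(2) unfolding x_def .
  show False
  proof (cases "even b")
    case False
    have "c 0 = asc D (x 1) (x 0)" using t(4)[of 0] False j j2 by (simp add: x_def)
    moreover have "even (L - 1 + b)" "Suc (L - 1) = L" using False j j2 by auto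
    then have "c (L - 1) = asc D (x (L - 1)) (x L)" using t(4)[of "L - 1"] by (simp add: x_def)
    moreover have "c 1 = asc D (x 1) (x 2)"
      using t(4)[of 1] False j j2 by (simp add: x_def numeral_2_eq_2[symmetric])
    \<comment> \<open>\<open>c 0\<close> and \<open>c 1\<close> have the same major key
      \<open>x 1\<close>, and \<open>c (L - 1)\<close> lies between them.\<close>
    moreover have "c 1 \<le> c (L - 1)" using mu(4) mu(5)[of 1] mu(2,3) by linarith
    ultimately have "x 1 = x (L - 1)"
      using c0 xb j j2 maj[of "x 1" "x 2" "x (L - 1)" "x L"] maj[of "x (L - 1)" "x L" "x 1" "x 0"] by auto
    moreover have "1 < L - 1" "L - 1 \<le> L" "L - 1 \<le> 1 + 2 * k" using L j j2 by auto
    ultimately show False using flips_neq[OF f t(1) d] by blast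
  next
    case True
    have ce: "c (2 * l) = asc D (x (2 * l)) (x (2 * l + 1))" if "l < j" for l
      using t(4)[of "2 * l"] that True j by (simp add: x_def)
    have co: "c (2 * l + 1) = asc D (x (2 * l + 2)) (x (2 * l + 1))" if "l < j" for l
      using t(4)[of "2 * l + 1"] that True j by (simp add: x_def)
    have last: "c (L - 1) = asc D (x (2 * j)) (x (2 * j - 1))"
      using co[of "j - 1"] j j2 by (cases j) simp_all
    have f0: "flips 0 (2 * j) x \<tau>" using f True j unfolding flips_def by simp
    have w0: "walk E (Suc 0) (2 * j) (\<lambda>n. tl (v n)) \<tau>"
      using t(1) True walk_parity[of "Suc b" "Suc 0" E] j by simp
    have le0: "x (2 * j) \<le> x 0"
      using c0 ce[of 0] last j j2 xb maj[of "x (2 * j)" "x (2 * j - 1)" "x 0" "x 1"] by simp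
    obtain V where V: "V < j" "\<And>n. 2 * V + 1 < n \<Longrightarrow> n < 2 * j \<Longrightarrow> \<tau> n < \<tau> (2 * V + 1)"
      "x (2 * j) < x (2 * V)"
      using last_top_step[OF f0 w0 d _ _ le0] j2 L j by auto
    obtain u where u: "\<mu> = 2 * u" using mu by (auto elim: evenE)
    have uj: "0 < u" "u < j" using u mu j by auto
    have low: "x (2 * l) \<le> x (2 * j)" if "0 < l" "l < j" for l
    proof -
      have "c (2 * l) \<le> c (L - 1)" using mu(4) mu(5)[of "2 * l"] that j by fastforce
      then show ?thesis using ce[of l] last that j xb by (auto dest!: maj)
    qed
    \<comment> \<open>By \<open>low\<close> no inner \<open>x (2 * l)\<close> exceeds
      \<open>x (2 * j)\<close>, but \<open>x (2 * V)\<close> does.\<close>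
    have V0: "V = 0" using low[of V] V by fastforce
    have high: "x (2 * l) \<le> x (2 * u)" if "0 < l" "l < j" for l
    proof -
      have "c (2 * l) \<le> c (2 * u)" using mu(5)[of "2 * l"] that j u by fastforce
      then show ?thesis using ce[of l] ce[of u] uj that j xb by (auto dest!: maj)
    qed
    \<comment> \<open>The maximum is now on the step out of position \<open>2 * u\<close>, not into
      it; with ties broken upwards the conclusion on the old colours is the same as for
      \<open>desc\<close>.\<close>
    have "asc D (x (2 * u)) (x (2 * u - 1)) \<le> asc D (x (2 * u)) (x (2 * u + 1))"
    proof -
      have "c (2 * (u - 1) + 1) \<le> c (2 * u)" using mu(5)[of "2 * (u - 1) + 1"] j u uj by fastforce
      then show ?thesis using uj ce[of u] co[of "u - 1"] by (cases u) simp_all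
    qed
    then have "x (2 * u - 1) \<le> x (2 * u + 1)" unfolding asc_def by simp
    moreover have "x (2 * u - 1) = x (2 * u) + 2 ^ \<tau> (2 * u - 1)" "x (2 * u + 1) = x (2 * u) + 2 ^ \<tau> (2 * u)"
      using flips_downD[OF f0, of "2 * u - 1"] flips_upD[OF f0, of "2 * u"] uj by simp_all
    ultimately have "\<tau> (2 * u - 1) \<le> \<tau> (2 * u)" by simp
    moreover have "\<tau> (2 * u - 1) \<noteq> \<tau> (Suc (2 * u - 1))"
      using walk_neq[OF w0, of "2 * u - 1"] uj by simp
    ultimately have "\<tau> (2 * u - 1) < \<tau> (2 * u)" using uj by simp
    then show False
      using ascents_below[OF f0 w0 d free, of 0 u] V(2) V0 high uj j L by auto
  qed
qed


section \<open>Dense graphs without pincers\<close>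

text \<open>A bipartite multigraph with a proper edge colouring: parallel edges are allowed as long
  as their colours differ.\<close>

definition coloured_graph :: "'a set \<Rightarrow> 'a set \<Rightarrow> nat \<Rightarrow> ('a \<times> 'a \<times> nat) set \<Rightarrow> bool" where
  "coloured_graph A B D E \<longleftrightarrow> finite A \<and> finite B \<and> E \<subseteq> A \<times> B \<times> {..<D} \<and>
     (\<forall>l r r' c. (l, r, c) \<in> E \<longrightarrow> (l, r', c) \<in> E \<longrightarrow> r = r') \<and>
     (\<forall>l l' r c. (l, r, c) \<in> E \<longrightarrow> (l', r, c) \<in> E \<longrightarrow> l = l')"

text \<open>Bound on the number of colours after \<open>k\<close> lifts of a graph with
  \<open>d\<close> colours.\<close>

primrec tower :: "nat \<Rightarrow> nat \<Rightarrow> nat" where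
  "tower 0 d = d"
| "tower (Suc k) d = 4 ^ tower k d"

text \<open>Adding \<open>2 ^ c\<close> matches the strings in which bit \<open>c\<close> is clear
  with those in which it is set.\<close>

lemma card_zero_bit:
  assumes "c < D"
  shows "card {y::nat. y < 2 ^ D \<and> even (y div 2 ^ c)} * 2 = 2 ^ D"
proof -
  let ?A = "{y::nat. y < 2 ^ D \<and> even (y div 2 ^ c)}"
  let ?B = "{y::nat. y < 2 ^ D \<and> odd (y div 2 ^ c)}"
  have "bij_betw (\<lambda>y. y + 2 ^ c) ?A ?B"
  proof (rule bij_betwI[where g = "\<lambda>y. y - 2 ^ c"])
    show "(\<lambda>y. y + 2 ^ c) \<in> ?A \<rightarrow> ?B" using flip_bound assms by auto
    have "(y - 2 ^ c) div 2 ^ c = y div 2 ^ c - 1 \<and> 2 ^ c \<le> y" if "odd (y div 2 ^ c)" for y :: nat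
    proof -
      have "y div 2 ^ c \<noteq> 0" using that by (intro notI) simp
      then have "2 ^ c \<le> y" by (metis div_less not_le)
      then show ?thesis by (simp add: le_div_geq)
    qed
    then show "(\<lambda>y. y - 2 ^ c) \<in> ?B \<rightarrow> ?A" "\<And>y. y \<in> ?B \<Longrightarrow> y - 2 ^ c + 2 ^ c = y"
      by (auto simp: less_imp_diff_less)
  qed auto
  then have "card ?A = card ?B" by (rule bij_betw_same_card)
  moreover have "card ?A + card ?B = card (?A \<union> ?B)"
    by (rule card_Un_disjoint[symmetric]) auto
  moreover have "?A \<union> ?B = {..<2 ^ D}" by auto
  ultimately show ?thesis by simp
qed

lemma card_flip_pairs:
  assumes "finite E" "\<And>e. e \<in> E \<Longrightarrow> snd (snd e) < D"
  shows "card (SIGMA e:E. {y::nat. y < 2 ^ D \<and> even (y div 2 ^ snd (snd e))}) * 2 = 2 ^ D * card E"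
proof -
  let ?Y = "\<lambda>e. {y::nat. y < 2 ^ D \<and> even (y div 2 ^ snd (snd e))}"
  have "card (Sigma E ?Y) = (\<Sum>e\<in>E. card (?Y e))" using assms(1) by (subst card_SigmaI) auto
  then have "card (Sigma E ?Y) * 2 = (\<Sum>e\<in>E. card (?Y e) * 2)"
    by (simp add: sum_distrib_right)
  also have "\<dots> = (\<Sum>e\<in>E. 2 ^ D)" using card_zero_bit assms(2) by (intro sum.cong) auto
  finally show ?thesis by simp
qed

lemma card_lift:
  assumes "coloured_graph A B D E"
  shows "card (lift col D E) * 2 = 2 ^ D * card E"
proof -
  let ?P = "SIGMA e:E. {y::nat. y < 2 ^ D \<and> even (y div 2 ^ snd (snd e))}"
  let ?f = "\<lambda>((l, r, c), y). (y # r, (y + 2 ^ c) # l, col y (y + 2 ^ c))"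
  have "finite E" "\<And>e. e \<in> E \<Longrightarrow> snd (snd e) < D"
    using assms finite_subset[of E "A \<times> B \<times> {..<D}"] unfolding coloured_graph_def by auto
  then have "card ?P * 2 = 2 ^ D * card E" by (rule card_flip_pairs)
  moreover have "lift col D E = ?f ` ?P"
    unfolding lift_def by (force simp: image_iff)
  moreover have "inj_on ?f ?P"
    by (auto simp: inj_on_def)
  ultimately show ?thesis by (simp add: card_image)
qed

text \<open>A new colour determines both strings and hence the old colour, as the bit in which they
  differ; so properness is inherited from \<open>E\<close>.\<close>

lemma coloured_graph_lift:
  assumes g: "coloured_graph A B D E" and col: "major_first D col"
  shows "coloured_graph (case_prod (#) ` ({..<2 ^ D} \<times> B)) (case_prod (#) ` ({..<2 ^ D} \<times> A)) (4 ^ D)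
    (lift col D E)"
proof -
  have E: "E \<subseteq> A \<times> B \<times> {..<D}" "finite A" "finite B"
    using g unfolding coloured_graph_def by simp_all
  have proper: "r = r'" if "(l, r, c) \<in> E" "(l, r', c) \<in> E" for l r r' c
    using g that unfolding coloured_graph_def by (elim conjE) metis
  have proper': "l = l'" if "(l, r, c) \<in> E" "(l', r, c) \<in> E" for l l' r c
    using g that unfolding coloured_graph_def by (elim conjE) metis
  have elim: "\<exists>l r t y. p = y # r \<and> q = (y + 2 ^ t) # l \<and> c = col y (y + 2 ^ t) \<and> (l, r, t) \<in> E \<and>
      l \<in> A \<and> r \<in> B \<and> y < 2 ^ D \<and> y + 2 ^ t < 2 ^ D" if "(p, q, c) \<in> lift col D E" for p q c
  proof -
    from that obtain l r t y where *: "p = y # r" "q = (y + 2 ^ t) # l" "c = col y (y + 2 ^ t)"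
      "(l, r, t) \<in> E" "y < 2 ^ D" "even (y div 2 ^ t)" unfolding lift_def by blast
    moreover have "l \<in> A" "r \<in> B" "t < D" using E(1) *(4) by auto
    ultimately show ?thesis using flip_bound by blast
  qed
  have colD: "p = p' \<and> q = q'" if "col p q = col p' q'" "p < 2 ^ D" "q < 2 ^ D" "p' < 2 ^ D" "q' < 2 ^ D"
    for p q p' q' using that col unfolding major_first_def by blast
  have colb: "col p q < 4 ^ D" if "p < 2 ^ D" "q < 2 ^ D" for p q
    using that col unfolding major_first_def by blast
  show ?thesis
    unfolding coloured_graph_def
  proof (intro conjI allI impI)
    show "lift col D E \<subseteq> case_prod (#) ` ({..<2 ^ D} \<times> B) \<times> case_prod (#) ` ({..<2 ^ D} \<times> A) \<times> {..<4 ^ D}"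
    proof
      fix e assume "e \<in> lift col D E"
      then show "e \<in> case_prod (#) ` ({..<2 ^ D} \<times> B) \<times> case_prod (#) ` ({..<2 ^ D} \<times> A) \<times> {..<4 ^ D}"
        using elim[of "fst e" "fst (snd e)" "snd (snd e)"] colb
        by (cases e) (auto simp: image_iff)
    qed
    fix p q q' c assume *: "(p, q, c) \<in> lift col D E" "(p, q', c) \<in> lift col D E"
    from elim[OF *(1)] obtain l r t y where 1: "p = y # r" "q = (y + 2 ^ t) # l" "c = col y (y + 2 ^ t)"
      "(l, r, t) \<in> E" "y < 2 ^ D" "y + 2 ^ t < 2 ^ D" by blast
    from elim[OF *(2)] obtain l' r' t' y' where 2: "p = y' # r'" "q' = (y' + 2 ^ t') # l'"
      "c = col y' (y' + 2 ^ t')" "(l', r', t') \<in> E" "y' < 2 ^ D" "y' + 2 ^ t' < 2 ^ D" by blast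
    have "y = y' \<and> y + 2 ^ t = y' + 2 ^ t'" using colD 1 2 by metis
    moreover from this have "(2::nat) ^ t = 2 ^ t'" by linarith
    then have "t = t'" by (simp add: power_inject_exp)
    ultimately show "q = q'" using 1 2 proper' by simp
  next
    fix p p' q c assume *: "(p, q, c) \<in> lift col D E" "(p', q, c) \<in> lift col D E"
    from elim[OF *(1)] obtain l r t y where 1: "p = y # r" "q = (y + 2 ^ t) # l" "c = col y (y + 2 ^ t)"
      "(l, r, t) \<in> E" "y < 2 ^ D" "y + 2 ^ t < 2 ^ D" by blast
    from elim[OF *(2)] obtain l' r' t' y' where 2: "p' = y' # r'" "q = (y' + 2 ^ t') # l'"
      "c = col y' (y' + 2 ^ t')" "(l', r', t') \<in> E" "y' < 2 ^ D" "y' + 2 ^ t' < 2 ^ D" by blast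
    have "y = y' \<and> y + 2 ^ t = y' + 2 ^ t'" using colD 1 2 by metis
    moreover from this have "(2::nat) ^ t = 2 ^ t'" by linarith
    then have "t = t'" by (simp add: power_inject_exp)
    ultimately show "p = p'" using 1 2 proper by simp
  qed (use E in auto)
qed

lemma coloured_graph_colours: "coloured_graph A B D E \<Longrightarrow> \<forall>l r c. (l, r, c) \<in> E \<longrightarrow> c < D"
  unfolding coloured_graph_def by auto

lemma card_Cons: "card (case_prod (#) ` ({..<n} \<times> A)) = n * card A"
  by (subst card_image) (auto simp: inj_on_def card_cartesian_product)

text \<open>Parallel edges of all colours are harmless: their lifts are no longer parallel.\<close>

lemma parallel_edges:
  obtains A B :: "nat list set" and E where "coloured_graph A B d E" "card A + card B = 2 * N" "card E = N * d"
    "distinct_runs 1 E" "ascent_free 1 E"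
proof -
  let ?A = "(\<lambda>u::nat. [u]) ` {..<N}"
  let ?f = "\<lambda>(u::nat, c::nat). ([u], [u], c)"
  let ?E = "?f ` ({..<N} \<times> {..<d})"
  have "coloured_graph ?A ?A d ?E" unfolding coloured_graph_def by auto
  moreover have "card ?A = N" by (subst card_image) (auto simp: inj_on_def)
  moreover have "card ?E = N * d" by (subst card_image) (auto simp: inj_on_def card_cartesian_product)
  moreover have "distinct_runs 1 ?E"
    unfolding distinct_runs_def
  proof (intro allI impI)
    fix b L v c assume L: "L \<le> 2 * 1" and w: "walk ?E b L v c"
    have "c i \<noteq> c j" if "i < j" "j < L" for i j
    proof -
      have "j = Suc i" using that L by simp
      then show ?thesis using walk_neq[OF w] that by blast
    qed
    then show "inj_on c {..<L}" by (metis (mono_tags) inj_onI lessThan_iff linorder_neqE_nat)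
  qed
  \<comment> \<open>For \<open>i = 1\<close> the first two clauses of \<open>ascents\<close>
    contradict each other.\<close>
  moreover have "ascent_free 1 ?E"
    unfolding ascent_free_def ascents_def by (auto simp: le_antisym)
  ultimately show thesis using that[of ?A ?A ?E] by simp
qed

text \<open>The invariant says, without division, that there are \<open>d / 2 ^ k\<close> edges per
  vertex; a lift halves this density.\<close>

lemma lift_sizes:
  assumes g: "coloured_graph A B D E" and col: "major_first D col"
    and c: "card A + card B = m * N" "card E * 2 ^ k = m * N * d"
  obtains A' B' where "coloured_graph A' B' (4 ^ D) (lift col D E)" "card A' + card B' = m * 2 ^ D * N"
    "card (lift col D E) * 2 ^ Suc k = m * 2 ^ D * N * d"
proof -
  have "2 ^ D * card B + 2 ^ D * card A = m * 2 ^ D * N"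
    using c(1) by (metis distrib_left add.commute mult.assoc mult.commute)
  moreover have "card (lift col D E) * 2 ^ Suc k = m * 2 ^ D * N * d"
  proof -
    have "card (lift col D E) * 2 ^ Suc k = (card (lift col D E) * 2) * 2 ^ k" by simp
    also have "\<dots> = 2 ^ D * (card E * 2 ^ k)" unfolding card_lift[OF g] by simp
    finally show ?thesis unfolding c by simp
  qed
  ultimately show thesis
    using that coloured_graph_lift[OF g col] by (simp add: card_Cons)
qed

lemma tower_step:
  fixes m D :: nat
  assumes "m * 2 ^ D \<le> 4 ^ D"
  shows "m * 2 ^ D * 2 ^ 4 ^ D \<le> 4 ^ 4 ^ D"
proof -
  have "m * 2 ^ D * 2 ^ 4 ^ D \<le> 4 ^ D * 2 ^ 4 ^ D" using assms by simp
  also have "\<dots> \<le> 2 ^ 4 ^ D * 2 ^ 4 ^ D" using less_exp[of "4 ^ D"] by simp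
  also have "\<dots> = 4 ^ 4 ^ D" by (simp flip: power_mult_distrib)
  finally show ?thesis .
qed

lemma two_power_le_four_power: "1 \<le> d \<Longrightarrow> 2 * (2::nat) ^ d \<le> 4 ^ d"
proof -
  assume "1 \<le> d"
  then have "2 * (2::nat) ^ d \<le> 2 ^ d * 2 ^ d"
    using self_le_power[of "2::nat" d] by simp
  then show ?thesis by (simp flip: power_mult_distrib)
qed

text \<open>\<open>m\<close> is the size of a block and \<open>N\<close> the free number of blocks.
  The bound on \<open>m * 2 ^ tower k d\<close> ensures that a block stays below the next tower
  value after one further replacement of vertices by bit strings, which is finally the one in the
  plane.\<close>

lemma ascent_free_graphs:
  assumes "1 \<le> d"
  shows "\<exists>m. 0 < m \<and> m * 2 ^ tower k d \<le> tower (Suc k) d \<and>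
    (\<forall>N. \<exists>A B E. coloured_graph (A :: nat list set) B (tower k d) E \<and>
       card A + card B = m * N \<and> card E * 2 ^ Suc k = m * N * d \<and>
       distinct_runs (Suc k) E \<and> ascent_free (Suc k) E)"
proof (induction k)
  case 0
  have "\<exists>A B E. coloured_graph (A :: nat list set) B d E \<and> card A + card B = 2 * N \<and>
      card E * 2 = 2 * N * d \<and> distinct_runs (Suc 0) E \<and> ascent_free (Suc 0) E" for N
  proof -
    obtain A B :: "nat list set" and E where "coloured_graph A B d E" "card A + card B = 2 * N"
      "card E = N * d" "distinct_runs 1 E" "ascent_free 1 E" by (rule parallel_edges)
    then show ?thesis by (intro exI[of _ A] exI[of _ B] exI[of _ E]) simp
  qed
  then show ?case using two_power_le_four_power[OF assms] by (intro exI[of _ 2]) auto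
next
  case (Suc k)
  define D :: nat where "D = tower k d"
  from Suc obtain m where m: "0 < m" "m * 2 ^ D \<le> 4 ^ D"
    and ex: "\<And>N. \<exists>A B E. coloured_graph (A :: nat list set) B D E \<and> card A + card B = m * N \<and>
       card E * 2 ^ Suc k = m * N * d \<and> distinct_runs (Suc k) E \<and> ascent_free (Suc k) E"
    unfolding D_def by auto
  have "\<exists>A B E. coloured_graph (A :: nat list set) B (4 ^ D) E \<and> card A + card B = m * 2 ^ D * N \<and>
       card E * 2 ^ Suc (Suc k) = m * 2 ^ D * N * d \<and> distinct_runs (Suc (Suc k)) E \<and> ascent_free (Suc (Suc k)) E"
    for N
  proof -
    obtain A B E where g: "coloured_graph (A :: nat list set) B D E" and c: "card A + card B = m * N"
      "card E * 2 ^ Suc k = m * N * d" and d: "distinct_runs (Suc k) E" and a: "ascent_free (Suc k) E"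
      using ex by blast
    show ?thesis
      using lift_sizes[OF g major_first_desc c]
        distinct_runs_lift[OF d coloured_graph_colours[OF g] major_first_desc]
        ascent_free_lift[OF d a coloured_graph_colours[OF g]] by metis
  qed
  then show ?case using m(1) tower_step[OF m(2)]
    by (intro exI[of _ "m * 2 ^ D"]) (simp flip: D_def)
qed

lemma pincer_free_1: "pincer_free (Suc 0) E"
  unfolding pincer_free_def pincers_def by auto

text \<open>All lifts use \<open>desc\<close> except the last, which uses \<open>asc\<close>. With
  no lift at all there are no pincers, since a walk of at most two steps has no inner step.\<close>

lemma pincer_free_graphs:
  assumes "1 \<le> d"
  shows "\<exists>m. 0 < m \<and> m * 2 ^ tower k d \<le> tower (Suc k) d \<and>
    (\<forall>N. \<exists>A B E. coloured_graph (A :: nat list set) B (tower k d) E \<and>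
       card A + card B = m * N \<and> card E * 2 ^ Suc k = m * N * d \<and>
       distinct_runs (Suc k) E \<and> pincer_free (Suc k) E)"
proof (cases k)
  case 0
  then show ?thesis using ascent_free_graphs[OF assms, of 0] pincer_free_1 by metis
next
  case (Suc j)
  define D :: nat where "D = tower j d"
  from ascent_free_graphs[OF assms, of j] obtain m where m: "0 < m" "m * 2 ^ D \<le> 4 ^ D"
    and ex: "\<And>N. \<exists>A B E. coloured_graph (A :: nat list set) B D E \<and> card A + card B = m * N \<and>
       card E * 2 ^ Suc j = m * N * d \<and> distinct_runs (Suc j) E \<and> ascent_free (Suc j) E"
    unfolding D_def by auto
  have "\<exists>A B E. coloured_graph (A :: nat list set) B (4 ^ D) E \<and> card A + card B = m * 2 ^ D * N \<and>
       card E * 2 ^ Suc (Suc j) = m * 2 ^ D * N * d \<and> distinct_runs (Suc (Suc j)) E \<and> pincer_free (Suc (Suc j)) E"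
    for N
  proof -
    obtain A B E where g: "coloured_graph (A :: nat list set) B D E" and c: "card A + card B = m * N"
      "card E * 2 ^ Suc j = m * N * d" and d: "distinct_runs (Suc j) E" and a: "ascent_free (Suc j) E"
      using ex by blast
    show ?thesis
      using lift_sizes[OF g major_first_asc c]
        distinct_runs_lift[OF d coloured_graph_colours[OF g] major_first_asc]
        pincer_free_lift[OF d a coloured_graph_colours[OF g]] by metis
  qed
  then show ?thesis unfolding Suc using m(1) tower_step[OF m(2)]
    by (intro exI[of _ "m * 2 ^ D"]) (simp flip: D_def)
qed

section \<open>Slopes\<close>

definition bit_sum :: "(nat \<Rightarrow> real) \<Rightarrow> nat \<Rightarrow> nat \<Rightarrow> real" where
  "bit_sum f D x = (\<Sum>i<D. if odd (x div 2 ^ i) then f i else 0)"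

lemma bit_sum_add:
  assumes "even (x div 2 ^ c)" "c < D"
  shows "bit_sum f D (x + 2 ^ c) = bit_sum f D x + f c"
proof -
  have "odd ((x + 2 ^ c) div 2 ^ i) = (if i = c then True else odd (x div 2 ^ i))" for i
  proof -
    consider "i < c" | "i = c" | "c < i" by linarith
    then show ?thesis
    proof cases
      case 1
      then have "(2::nat) ^ c = 2 * 2 ^ (c - Suc i) * 2 ^ i"
        by (simp flip: power_add power_Suc)
      then have "(x + 2 ^ c) div 2 ^ i = x div 2 ^ i + 2 * 2 ^ (c - Suc i)" by simp
      then show ?thesis using 1 by simp
    next
      case 3
      then show ?thesis using no_carry[OF assms(1)] by simp
    qed (use assms(1) in simp)
  qed
  then have "bit_sum f D (x + 2 ^ c) = (\<Sum>i<D. (if odd (x div 2 ^ i) then f i else 0) + (if i = c then f i else 0))"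
    unfolding bit_sum_def using assms by (intro sum.cong) auto
  then show ?thesis using assms(2) by (simp add: sum.distrib bit_sum_def)
qed

text \<open>The bits above \<open>m\<close> cancel, bit \<open>m\<close> contributes
  \<open>f m\<close>, and the lower bits contribute at most their total weight in absolute
  value.\<close>

lemma bit_sum_rises:
  assumes r: "rises m x y" and m: "m < D" and f: "\<And>i. i < D \<Longrightarrow> 0 \<le> f i"
  shows "\<bar>bit_sum f D y - bit_sum f D x - f m\<bar> \<le> (\<Sum>i<m. f i)"
proof -
  let ?g = "\<lambda>i. (if odd (y div 2 ^ i) then f i else 0) - (if odd (x div 2 ^ i) then f i else 0)"
  have high: "y div 2 ^ i = x div 2 ^ i" if "m < i" for i
  proof -
    have "y div 2 ^ Suc m = x div 2 ^ Suc m"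
      using r unfolding rises_def by (auto simp: div_mult2_eq power_Suc2 simp del: power_Suc elim!: evenE)
    moreover obtain t where "i = Suc m + t" using less_imp_Suc_add[OF \<open>m < i\<close>] by auto
    ultimately show ?thesis by (simp only: power_add div_mult2_eq)
  qed
  have "bit_sum f D y - bit_sum f D x = (\<Sum>i<D. ?g i)"
    unfolding bit_sum_def by (simp add: sum_subtractf)
  also have "\<dots> = (\<Sum>i<Suc m. ?g i)"
    using m high by (intro sum.mono_neutral_right) auto
  also have "\<dots> = (\<Sum>i<m. ?g i) + f m" using r unfolding rises_def by simp
  finally have "\<bar>bit_sum f D y - bit_sum f D x - f m\<bar> = \<bar>\<Sum>i<m. ?g i\<bar>" by simp
  also have "\<dots> \<le> (\<Sum>i<m. f i)" using f m by (intro order.trans[OF sum_abs] sum_mono) auto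
  finally show ?thesis .
qed

text \<open>The last condition says that the slope of a bit \<open>m\<close> is well below that of an edge of colour
  \<open>n > m\<close>, which is about \<open>\<beta> n\<close>.\<close>

definition scales :: "nat \<Rightarrow> (nat \<Rightarrow> real) \<Rightarrow> (nat \<Rightarrow> real) \<Rightarrow> bool" where
  "scales D \<alpha> \<beta> \<longleftrightarrow>
     (\<forall>m<D. 0 < \<alpha> m \<and> \<alpha> m \<le> 1 / 8 \<and> 0 < \<beta> m \<and> (\<Sum>i<m. \<alpha> i) \<le> \<alpha> m / 8 \<and> (\<Sum>i<m. \<beta> i) \<le> \<beta> m / 8) \<and>
     (\<forall>m n. m < n \<longrightarrow> n < D \<longrightarrow> 8 * \<beta> m \<le> \<alpha> m * \<beta> n)"

lemma sum_geometric_le: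
  fixes f :: "nat \<Rightarrow> real"
  assumes "\<And>i. i < m \<Longrightarrow> f i \<le> f (Suc i) / 16" "0 \<le> f 0"
  shows "(\<Sum>i<m. f i) \<le> f m / 8"
  using assms(1)
proof (induction m)
  case (Suc m)
  then have *: "(\<Sum>i<m. f i) \<le> f m / 8" "f m \<le> f (Suc m) / 16" by auto
  have "0 \<le> f m"
    using Suc.prems
  proof (induction m)
    case (Suc n)
    then have "0 \<le> f n" "f n \<le> f (Suc n) / 16" by auto
    then show ?case by linarith
  qed (use assms in simp)
  then show ?case using * by simp
qed (use assms in auto)

lemma scales_exist:
  assumes "0 < \<delta>"
  obtains \<alpha> \<beta> where "scales D \<alpha> \<beta>" "(\<Sum>i<D. \<alpha> i) \<le> \<delta>" "(\<Sum>i<D. \<beta> i) \<le> \<delta>"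
proof -
  define \<rho> where "\<rho> = min (1 / 16) (\<delta> / 2)"
  have \<rho>: "0 < \<rho>" "\<rho> \<le> 1 / 16" "\<rho> \<le> \<delta> / 2" using assms unfolding \<rho>_def by auto
  have le: "\<rho> ^ a \<le> \<rho> ^ b" if "b \<le> a" for a b using that \<rho> by (intro power_decreasing) auto
  have le16: "\<rho> ^ a \<le> \<rho> ^ b / 16" if "b < a" for a b
  proof -
    have "\<rho> ^ a \<le> \<rho> ^ Suc b" using that by (intro le) simp
    also have "\<dots> \<le> \<rho> ^ b / 16" using \<rho> by simp
    finally show ?thesis .
  qed
  \<comment> \<open>Linear and quadratic exponents: for \<open>m < n\<close> the product
    \<open>(D - n) * (D - n + 1)\<close> is smaller than the square of \<open>D - m\<close>, so
    \<open>\<beta> m\<close> is a higher power of \<open>\<rho>\<close> than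
    \<open>\<alpha> m * \<beta> n\<close>.\<close>
  define \<alpha> where "\<alpha> i = \<rho> ^ (D - i)" for i
  define \<beta> where "\<beta> i = \<rho> ^ ((D - i) * (D - i + 1))" for i
  have sum: "(\<Sum>i<m. \<alpha> i) \<le> \<alpha> m / 8" "(\<Sum>i<m. \<beta> i) \<le> \<beta> m / 8" if "m \<le> D" for m
    using that \<rho> unfolding \<alpha>_def \<beta>_def
    by (intro sum_geometric_le le16 mult_strict_mono; simp)+
  have one: "\<alpha> m \<le> \<rho>" "\<beta> m \<le> \<rho>" if "m < D" for m
    using le[of 1 "D - m"] le[of 1 "(D - m) * (D - m + 1)"] that unfolding \<alpha>_def \<beta>_def by auto
  have "8 * \<beta> m \<le> \<alpha> m * \<beta> n" if "m < n" "n < D" for m n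
  proof -
    obtain p where p: "D - n = Suc p" using \<open>n < D\<close> by (metis Suc_diff_Suc)
    define q where "q = n - m - 1"
    have q: "D - m = Suc (Suc p + q)" using p that unfolding q_def by linarith
    have "D - m + (D - n) * (D - n + 1) < (D - m) * (D - m + 1)"
      unfolding p q by (simp add: algebra_simps)
    from le16[OF this] have "16 * \<beta> m \<le> \<alpha> m * \<beta> n"
      unfolding \<alpha>_def \<beta>_def by (simp add: power_add)
    moreover have "0 \<le> \<beta> m" unfolding \<beta>_def using \<rho> by simp
    ultimately show ?thesis by simp
  qed
  moreover have "0 < \<alpha> m" "0 < \<beta> m" for m unfolding \<alpha>_def \<beta>_def using \<rho> by auto
  moreover have "\<alpha> m \<le> 1 / 8" if "m < D" for m using one(1)[OF that] \<rho> by linarith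
  ultimately have "scales D \<alpha> \<beta>"
    unfolding scales_def using sum by (simp add: less_imp_le)
  moreover have "(\<Sum>i<D. \<alpha> i) \<le> \<delta>" "(\<Sum>i<D. \<beta> i) \<le> \<delta>"
  proof -
    show "(\<Sum>i<D. \<alpha> i) \<le> \<delta>" "(\<Sum>i<D. \<beta> i) \<le> \<delta>"
      using sum[of "D - 1"] one[of "D - 1"] \<rho> assms by (cases D; simp)+
  qed
  ultimately show thesis using that by blast
qed

text \<open>Up to a positive factor, the orientation of the left or right point of \<open>x'\<close> with respect to
  the edge of colour \<open>c\<close> whose left or right point, respectively, belongs to \<open>x\<close>.\<close>

definition side :: "nat \<Rightarrow> (nat \<Rightarrow> real) \<Rightarrow> (nat \<Rightarrow> real) \<Rightarrow> nat \<Rightarrow> nat \<Rightarrow> nat \<Rightarrow> real" where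
  "side D \<alpha> \<beta> c x x' =
     (1 + \<alpha> c) * (bit_sum \<beta> D x' - bit_sum \<beta> D x) - \<beta> c * (bit_sum \<alpha> D x' - bit_sum \<alpha> D x)"

lemma side_swap: "side D \<alpha> \<beta> c x' x = - side D \<alpha> \<beta> c x x'"
  unfolding side_def by (simp add: algebra_simps)

text \<open>The displacement from \<open>x\<close> to \<open>x'\<close> is
  \<open>(\<alpha> m, \<beta> m)\<close> up to an eighth of each coordinate, and an edge of colour
  \<open>c\<close> has direction \<open>(1 + \<alpha> c, \<beta> c)\<close>. The displacement is
  steeper than the edge if \<open>c \<le> m\<close> and flatter if \<open>m < c\<close>.\<close>

lemma
  assumes s: "scales D \<alpha> \<beta>" and r: "rises m x x'" and D: "m < D" "c < D"
  shows side_pos: "c \<le> m \<Longrightarrow> 0 < side D \<alpha> \<beta> c x x'"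
    and side_neg: "m < c \<Longrightarrow> side D \<alpha> \<beta> c x x' < 0"
proof -
  define u where "u = bit_sum \<alpha> D x' - bit_sum \<alpha> D x"
  define w where "w = bit_sum \<beta> D x' - bit_sum \<beta> D x"
  have pos: "0 < \<alpha> m" "\<alpha> m \<le> 1 / 8" "0 < \<beta> m" "0 < \<alpha> c" "\<alpha> c \<le> 1 / 8" "0 < \<beta> c"
    and sums: "(\<Sum>i<m. \<alpha> i) \<le> \<alpha> m / 8" "(\<Sum>i<m. \<beta> i) \<le> \<beta> m / 8"
    using s D unfolding scales_def by auto
  have "\<bar>u - \<alpha> m\<bar> \<le> \<alpha> m / 8"
    using bit_sum_rises[OF r D(1), of \<alpha>] sums s unfolding u_def scales_def by (force simp: less_imp_le)
  then have u: "7 / 8 * \<alpha> m \<le> u" "u \<le> 9 / 8 * \<alpha> m" by linarith+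
  have "\<bar>w - \<beta> m\<bar> \<le> \<beta> m / 8"
    using bit_sum_rises[OF r D(1), of \<beta>] sums s unfolding w_def scales_def by (force simp: less_imp_le)
  then have w: "7 / 8 * \<beta> m \<le> w" "w \<le> 9 / 8 * \<beta> m" by linarith+
  have eq: "side D \<alpha> \<beta> c x x' = (1 + \<alpha> c) * w - \<beta> c * u" unfolding side_def u_def w_def ..
  show "0 < side D \<alpha> \<beta> c x x'" if "c \<le> m"
  proof -
    have "\<beta> c \<le> \<beta> m"
    proof (cases "c = m")
      case False
      then have "8 * \<beta> c \<le> \<alpha> c * \<beta> m" using s that D unfolding scales_def by simp
      also have "\<dots> \<le> 1 * \<beta> m" using pos by (intro mult_right_mono) auto
      finally show ?thesis using pos by simp
    qed simp
    then have "\<beta> c * u \<le> \<beta> m * (9 / 64)" using u pos by (intro mult_mono) auto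
    moreover have "1 * (7 / 8 * \<beta> m) \<le> (1 + \<alpha> c) * w" using w pos by (intro mult_mono) auto
    ultimately show ?thesis unfolding eq using pos by simp
  qed
  show "side D \<alpha> \<beta> c x x' < 0" if "m < c"
  proof -
    have "8 * \<beta> m \<le> \<alpha> m * \<beta> c" using s that D unfolding scales_def by simp
    moreover have "7 / 8 * (\<alpha> m * \<beta> c) \<le> \<beta> c * u"
      using mult_left_mono[OF u(1), of "\<beta> c"] pos by (simp add: ac_simps)
    moreover have "(1 + \<alpha> c) * w \<le> (9 / 8) * (9 / 8 * \<beta> m)" using w pos by (intro mult_mono) auto
    ultimately show ?thesis unfolding eq using pos by linarith
  qed
qed

section \<open>Relative position of the two end edges of a walk\<close>

lemma flips_rev:
  assumes "flips b L x c"
  shows "flips (b + L) L (\<lambda>n. x (L - n)) (\<lambda>n. c (L - 1 - n))"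
  unfolding flips_def
proof (intro allI impI)
  fix n assume n: "n < L"
  have "L - 1 - n < L" "Suc (L - 1 - n) = L - n" "L - Suc n = L - 1 - n" using n by auto
  moreover have "even (n + (b + L)) \<longleftrightarrow> odd (L - 1 - n + b)" using n by auto
  ultimately show "if even (n + (b + L))
      then x (L - Suc n) = x (L - n) + 2 ^ c (L - 1 - n) \<and> even (x (L - n) div 2 ^ c (L - 1 - n))
      else x (L - n) = x (L - Suc n) + 2 ^ c (L - 1 - n) \<and> even (x (L - Suc n) div 2 ^ c (L - 1 - n))"
    using assms unfolding flips_def by metis
qed

lemma walk_rev:
  assumes "walk E b L v c"
  shows "walk E (b + L) L (\<lambda>n. v (L - n)) (\<lambda>n. c (L - 1 - n))"
  unfolding walk_def
proof (intro conjI allI impI)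
  fix n assume n: "n < L"
  have "L - 1 - n < L" "Suc (L - 1 - n) = L - n" "L - Suc n = L - 1 - n" using n by auto
  moreover have "even (n + (b + L)) \<longleftrightarrow> odd (L - 1 - n + b)" using n by auto
  ultimately show "if even (n + (b + L)) then (v (L - n), v (L - Suc n), c (L - 1 - n)) \<in> E
      else (v (L - Suc n), v (L - n), c (L - 1 - n)) \<in> E"
    using assms unfolding walk_def by metis
next
  fix n assume n: "Suc n < L"
  then have "L - 1 - n = Suc (L - 1 - Suc n)" "Suc (L - 1 - Suc n) < L" by auto
  then show "c (L - 1 - n) \<noteq> c (L - 1 - Suc n)" using walk_neq[OF assms] by metis
qed

definition lft :: "nat \<Rightarrow> (nat \<Rightarrow> nat) \<Rightarrow> nat \<Rightarrow> nat" where
  "lft b x n = (if even (n + b) then x n else x (Suc n))"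

definition rgt :: "nat \<Rightarrow> (nat \<Rightarrow> nat) \<Rightarrow> nat \<Rightarrow> nat" where
  "rgt b x n = (if even (n + b) then x (Suc n) else x n)"

text \<open>The counterpart of \<open>apart\<close> for strings: one of the two edges has both ends
  of the other strictly on one side of its line.\<close>

definition sided :: "nat \<Rightarrow> (nat \<Rightarrow> real) \<Rightarrow> (nat \<Rightarrow> real) \<Rightarrow> nat \<Rightarrow> nat \<Rightarrow> nat \<Rightarrow> nat \<Rightarrow> nat \<Rightarrow> nat \<Rightarrow> bool" where
  "sided D \<alpha> \<beta> c x y c' x' y' \<longleftrightarrow>
     0 < side D \<alpha> \<beta> c x x' * side D \<alpha> \<beta> c y y' \<or> 0 < side D \<alpha> \<beta> c' x' x * side D \<alpha> \<beta> c' y' y"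

text \<open>On the side of the starting vertex the displacement between the end edges is governed by
  \<open>c 0\<close>, on the other side by the largest colour \<open>c \<mu>\<close> of the steps
  from 1 to \<open>t - 1\<close>. If \<open>\<mu>\<close> is even, the two displacements point the
  same way and both are steeper than the last edge. If \<open>\<mu>\<close> is odd, they point
  opposite ways, one steeper and one flatter than the first edge, so both ends of the last edge are
  on the same side of it.\<close>

lemma sided_first_top:
  assumes s: "scales D \<alpha> \<beta>" and f: "flips b L x c" and w: "walk E b L v c"
    and d: "distinct_runs k E" and free: "pincer_free k E" and L: "3 \<le> L" "L \<le> 2 * k + 1"
    and top: "\<And>n. 0 < n \<Longrightarrow> n < L \<Longrightarrow> c n < c 0" and D: "\<And>n. n < L \<Longrightarrow> c n < D"
  shows "sided D \<alpha> \<beta> (c 0) (lft b x 0) (rgt b x 0) (c (L - 1)) (lft b x (L - 1)) (rgt b x (L - 1))"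
proof -
  define e where "e = L - 1"
  have e: "L = Suc e" "2 \<le> e" using L e_def by auto
  \<comment> \<open>The end of the last edge on the side of position 1 is the one at an odd
    position.\<close>
  define t where "t = (if odd e then e else L)"
  have t: "2 \<le> t" "t \<le> L" using e unfolding t_def by auto
  obtain \<mu> where mu: "1 \<le> \<mu>" "\<mu> < t" "\<And>n. 1 \<le> n \<Longrightarrow> n < t \<Longrightarrow> c n \<le> c \<mu>"
    using argmax_interval[of 1 t c] t by auto
  have lt: "c n < c \<mu>" if "1 \<le> n" "n < t" "n \<noteq> \<mu>" for n
  proof -
    have "c n \<noteq> c \<mu>"
      using distinct_runsD[OF d w, of n \<mu>] distinct_runsD[OF d w, of \<mu> n] that mu t L
      by (cases "n < \<mu>") auto
    then show ?thesis using mu(3) that by (simp add: le_neq_implies_less)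
  qed
  \<comment> \<open>Otherwise step \<open>e\<close> is outside the range searched for
    \<open>\<mu>\<close>, so \<open>L\<close> is even and the walk is a pincer. Only here is
    \<open>pincer_free\<close> applied.\<close>
  have last: "c e \<le> c \<mu>" if "even \<mu>"
  proof (rule ccontr)
    assume neg: "\<not> c e \<le> c \<mu>"
    then have "t \<noteq> L" using mu(3)[of e] e by auto
    then have "odd e" "t = e" unfolding t_def by (auto split: if_splits)
    then have "pincers c L"
      unfolding pincers_def using neg mu that top[of e] e by (auto intro!: exI[of _ \<mu>])
    moreover have "L \<le> 2 * k" using \<open>odd e\<close> e L by presburger
    ultimately show False using free w unfolding pincer_free_def by blast
  qed
  have cD: "c 0 < D" "c e < D" "c \<mu> < D" "c e < c 0" "c \<mu> < c 0"
    using D top mu e t by auto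
  show ?thesis
  proof (cases "even b")
    case True
    have r0: "rises (c 0) (lft b x 0) (lft b x e)"
      unfolding lft_def using flips_up[OF f, of 0 0 e] flips_up[OF f, of 0 0 L] top e True by auto
    have y: "rgt b x 0 = x 1" "rgt b x e = x t" unfolding rgt_def t_def using True e by auto
    show ?thesis
    proof (cases "even \<mu>")
      case True
      then have "rises (c \<mu>) (rgt b x 0) (rgt b x e)"
        unfolding y using flips_up[OF f _ mu(1,2)] t lt \<open>even b\<close> by simp
      then have "0 < side D \<alpha> \<beta> (c e) (rgt b x 0) (rgt b x e)" "0 < side D \<alpha> \<beta> (c e) (lft b x 0) (lft b x e)"
        using side_pos[OF s] last[OF True] r0 cD by auto
      then show ?thesis
        unfolding sided_def e_def[symmetric]
        using side_swap[of D \<alpha> \<beta> _ "lft b x e"] side_swap[of D \<alpha> \<beta> _ "rgt b x e"] by simp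
    next
      case False
      then have "rises (c \<mu>) (rgt b x e) (rgt b x 0)"
        unfolding y using flips_down[OF f _ mu(1,2)] t lt \<open>even b\<close> by simp
      then have "side D \<alpha> \<beta> (c 0) (rgt b x e) (rgt b x 0) < 0" using side_neg[OF s] cD by blast
      moreover have "0 < side D \<alpha> \<beta> (c 0) (lft b x 0) (lft b x e)" using side_pos[OF s r0] cD by auto
      ultimately show ?thesis
        unfolding sided_def e_def[symmetric]
        using side_swap[of D \<alpha> \<beta> _ "rgt b x 0"] by (simp add: mult_pos_neg)
    qed
  next
    case False
    have r0: "rises (c 0) (rgt b x e) (rgt b x 0)"
      unfolding rgt_def using flips_down[OF f, of 0 0 e] flips_down[OF f, of 0 0 L] top e False by auto
    have y: "lft b x 0 = x 1" "lft b x e = x t" unfolding lft_def t_def using False e by auto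
    show ?thesis
    proof (cases "even \<mu>")
      case True
      then have "rises (c \<mu>) (lft b x e) (lft b x 0)"
        unfolding y using flips_down[OF f _ mu(1,2)] t lt False by simp
      then have "0 < side D \<alpha> \<beta> (c e) (lft b x e) (lft b x 0)" "0 < side D \<alpha> \<beta> (c e) (rgt b x e) (rgt b x 0)"
        using side_pos[OF s] last[OF True] r0 cD by auto
      then show ?thesis unfolding sided_def e_def[symmetric] by simp
    next
      case odd: False
      then have "rises (c \<mu>) (lft b x 0) (lft b x e)"
        unfolding y using flips_up[OF f _ mu(1,2)] t lt False by simp
      then have "side D \<alpha> \<beta> (c 0) (lft b x 0) (lft b x e) < 0" using side_neg[OF s] cD by blast
      moreover have "0 < side D \<alpha> \<beta> (c 0) (rgt b x e) (rgt b x 0)" using side_pos[OF s r0] cD by auto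
      ultimately show ?thesis
        unfolding sided_def e_def[symmetric]
        using side_swap[of D \<alpha> \<beta> _ "rgt b x 0"] by (simp add: mult_neg_pos)
    qed
  qed
qed

text \<open>\<open>distinct_runs\<close> leaves only the possibility that the first and the last of
  \<open>2 * k + 1\<close> steps both have the top colour. These go in the same direction, but no
  step in between resets the bit.\<close>

lemma unique_top:
  assumes f: "flips b L x c" and w: "walk E b L v c"
    and d: "distinct_runs k E" and L: "L \<le> 2 * k + 1"
    and s: "s < L" "\<And>n. n < L \<Longrightarrow> c n \<le> c s" and n: "n < L" "n \<noteq> s"
  shows "c n < c s"
proof -
  have *: False if "i < j" "j < L" "c i = c s" "c j = c s" for i j
  proof (cases "j < i + 2 * k")
    case True
    then show False using distinct_runsD[OF d w] that by metis
  next
    case False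
    then have ij: "i = 0" "j = 2 * k" "L = Suc j" using that L by auto
    have "c m < c s" if "1 \<le> m" "m < j" for m
    proof -
      have "c 0 \<noteq> c m" using distinct_runsD[OF d w, of 0 m] that ij by simp
      then show ?thesis using s(2)[of m] that ij \<open>c i = c s\<close> by simp
    qed
    then have "x j div 2 ^ c s = x 1 div 2 ^ c s" using flips_const[OF f, of 1 j "c s"] that ij by simp
    moreover have step: "if even (n + b) then x (Suc n) = x n + 2 ^ c n \<and> even (x n div 2 ^ c n)
             else x n = x (Suc n) + 2 ^ c n \<and> even (x (Suc n) div 2 ^ c n)" if "n < L" for n
      using f that unfolding flips_def by blast
    have "if even b then x 1 = x 0 + 2 ^ c s \<and> even (x 0 div 2 ^ c s)
        else x 0 = x 1 + 2 ^ c s \<and> even (x 1 div 2 ^ c s)"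
      using step[of 0] that ij by (simp split: if_splits)
    moreover have "if even b then x L = x j + 2 ^ c s \<and> even (x j div 2 ^ c s)
        else x j = x L + 2 ^ c s \<and> even (x L div 2 ^ c s)"
      using step[of j] that ij by (simp split: if_splits)
    ultimately show False by (auto split: if_splits) (metis even_Suc)
  qed
  have "c n \<noteq> c s"
    using *[of n s] *[of s n] s n by (cases "n < s") auto
  then show ?thesis using s(2)[OF n(1)] by simp
qed

text \<open>If the top colour is on the first step, or on the last one after reversal,
  \<open>sided_first_top\<close> applies. If it is strictly inside, it governs the displacements on
  both sides, which point the same way and are steeper than either end edge.\<close>

lemma walk_sided:
  assumes s: "scales D \<alpha> \<beta>" and f: "flips b L x c" and w: "walk E b L v c"
    and d: "distinct_runs k E" and free: "pincer_free k E" and L: "3 \<le> L" "L \<le> 2 * k + 1"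
    and D: "\<And>n. n < L \<Longrightarrow> c n < D"
  shows "sided D \<alpha> \<beta> (c 0) (lft b x 0) (rgt b x 0) (c (L - 1)) (lft b x (L - 1)) (rgt b x (L - 1))"
proof -
  obtain m where m: "m < L" "\<And>n. n < L \<Longrightarrow> c n \<le> c m"
    using argmax_interval[of 0 L c] L by auto
  have top: "c n < c m" if "n < L" "n \<noteq> m" for n
    using unique_top[OF f w d L(2) m that] .
  consider "m = 0" | "m = L - 1" | "0 < m" "m < L - 1" using m by linarith
  then show ?thesis
  proof cases
    case 1
    then show ?thesis using sided_first_top[OF s f w d free L] top D by simp
  next
    case 2
    have rev: "lft (b + L) (\<lambda>n. x (L - n)) 0 = lft b x (L - 1)" "rgt (b + L) (\<lambda>n. x (L - n)) 0 = rgt b x (L - 1)"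
      "lft (b + L) (\<lambda>n. x (L - n)) (L - 1) = lft b x 0" "rgt (b + L) (\<lambda>n. x (L - n)) (L - 1) = rgt b x 0"
      unfolding lft_def rgt_def using L by auto
    have "sided D \<alpha> \<beta> (c (L - 1)) (lft b x (L - 1)) (rgt b x (L - 1)) (c 0) (lft b x 0) (rgt b x 0)"
      using sided_first_top[OF s flips_rev[OF f] walk_rev[OF w] d free L, unfolded rev] top D 2 by simp
    then show ?thesis unfolding sided_def by blast
  next
    case 3
    show ?thesis
    proof (cases "even (m + b)")
      case True
      have "rises (c m) (x i) (x j)" if "i \<le> 1" "L - 1 \<le> j" "j \<le> L" for i j
        using flips_up[OF f True, of i j] that top 3 by auto
      then have "rises (c m) (lft b x 0) (lft b x (L - 1))" "rises (c m) (rgt b x 0) (rgt b x (L - 1))"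
        unfolding lft_def rgt_def using L by auto
      then show ?thesis
        using side_pos[OF s] m D[OF m(1)] D[of 0] L unfolding sided_def by simp
    next
      case False
      have "rises (c m) (x j) (x i)" if "i \<le> 1" "L - 1 \<le> j" "j \<le> L" for i j
        using flips_down[OF f False, of i j] that top 3 by auto
      then have "rises (c m) (lft b x (L - 1)) (lft b x 0)" "rises (c m) (rgt b x (L - 1)) (rgt b x 0)"
        unfolding lft_def rgt_def using L by auto
      then show ?thesis
        using side_pos[OF s] m D[OF m(1)] D[of "L - 1"] L unfolding sided_def by simp
    qed
  qed
qed

section \<open>Plane geometry\<close>

text \<open>Twice the signed area of the triangle \<open>p q z\<close>.\<close>

definition orient :: "real ^ 2 \<Rightarrow> real ^ 2 \<Rightarrow> real ^ 2 \<Rightarrow> real" where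
  "orient p q z = (q $ 1 - p $ 1) * (z $ 2 - p $ 2) - (q $ 2 - p $ 2) * (z $ 1 - p $ 1)"

lemma orient_swap: "orient p z q = - orient p q z" "orient q p z = - orient p q z"
  unfolding orient_def by (simp_all add: algebra_simps)

lemma orient_same [simp]: "orient p q p = 0" "orient p q q = 0"
  unfolding orient_def by simp_all

lemma orient_affine: "orient p q ((1 - t) *\<^sub>R u + t *\<^sub>R w) = (1 - t) * orient p q u + t * orient p q w"
  unfolding orient_def by (simp add: algebra_simps)

lemma orient_closed_segment:
  assumes "z \<in> closed_segment p q" shows "orient p q z = 0"
proof -
  obtain t where "z = (1 - t) *\<^sub>R p + t *\<^sub>R q" using assms unfolding closed_segment_def by blast
  then show ?thesis by (simp add: orient_affine)
qed

definition apart :: "real ^ 2 \<Rightarrow> real ^ 2 \<Rightarrow> real ^ 2 \<Rightarrow> real ^ 2 \<Rightarrow> bool" where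
  "apart p q p' q' \<longleftrightarrow> 0 < orient p q p' * orient p q q' \<or> 0 < orient p' q' p * orient p' q' q"

text \<open>The orientation is affine, so it keeps its sign along the second segment, whereas it
  vanishes on the first.\<close>

lemma open_segment_disjoint_side:
  assumes "0 < orient p q p' * orient p q q'"
  shows "open_segment p q \<inter> open_segment p' q' = {}"
proof (rule ccontr)
  assume "\<not> ?thesis"
  then obtain z where "z \<in> open_segment p q" "z \<in> open_segment p' q'" by blast
  then obtain t where t: "0 < t" "t < 1" "z = (1 - t) *\<^sub>R p' + t *\<^sub>R q'" and "z \<in> open_segment p q"
    unfolding in_segment(2)[of z p' q'] by blast
  then have "z \<in> closed_segment p q" using segment_open_subset_closed by blast
  with t(3) have 0: "(1 - t) * orient p q p' + t * orient p q q' = 0"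
    using orient_affine orient_closed_segment by metis
  consider "0 < orient p q p'" "0 < orient p q q'" | "orient p q p' < 0" "orient p q q' < 0"
    using assms by (auto simp: zero_less_mult_iff)
  then show False
  proof cases
    case 1
    then have "0 < (1 - t) * orient p q p' + t * orient p q q'" using t by (intro add_pos_pos mult_pos_pos) auto
    then show False using 0 by simp
  next
    case 2
    then have "(1 - t) * orient p q p' + t * orient p q q' < 0" using t by (intro add_neg_neg mult_pos_neg) auto
    then show False using 0 by simp
  qed
qed

lemma apart_disjoint: "apart p q p' q' \<Longrightarrow> open_segment p q \<inter> open_segment p' q' = {}"
  unfolding apart_def using open_segment_disjoint_side by blast

lemma open_segment_disjoint_common_end:
  assumes "orient p q z \<noteq> 0"
  shows "open_segment p q \<inter> open_segment q z = {}"
proof (rule ccontr)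
  assume "\<not> ?thesis"
  then obtain y where "y \<in> open_segment p q" "y \<in> open_segment q z" by blast
  then obtain t where t: "0 < t" "y = (1 - t) *\<^sub>R q + t *\<^sub>R z" and "y \<in> open_segment p q"
    unfolding in_segment(2)[of y q z] by blast
  then have "y \<in> closed_segment p q" using segment_open_subset_closed by blast
  with t(2) have "(1 - t) * orient p q q + t * orient p q z = 0"
    using orient_affine orient_closed_segment by metis
  then show False using t assms by simp
qed

text \<open>Strict inequalities between polynomials define an open set of quadruples.\<close>

lemma apart_stable:
  assumes "apart p q p' q'"
  obtains \<epsilon> where "0 < \<epsilon>" "\<And>a b a' b'. dist a p < \<epsilon> \<Longrightarrow> dist b q < \<epsilon> \<Longrightarrow> dist a' p' < \<epsilon> \<Longrightarrow> dist b' q' < \<epsilon> \<Longrightarrow>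
    apart a b a' b'"
proof -
  let ?S = "{z. apart (fst (fst z)) (snd (fst z)) (fst (snd z)) (snd (snd z))}"
  have "open ?S"
    unfolding apart_def orient_def by (intro open_Collect_disj open_Collect_less continuous_intros)
  moreover have "((p, q), (p', q')) \<in> ?S" using assms by simp
  ultimately obtain e where e: "0 < e" "ball ((p, q), (p', q')) e \<subseteq> ?S" by (meson open_contains_ball)
  have tri: "dist (a, b) (c, d) \<le> dist a c + dist b d" for a b c d :: "'b::metric_space"
    unfolding dist_Pair_Pair by (rule sqrt_sum_squares_le_sum) auto
  have tri2: "dist ((a, b), (a', b')) ((p, q), (p', q')) \<le> dist (a, b) (p, q) + dist (a', b') (p', q')"
    for a b a' b'
    unfolding dist_Pair_Pair[of "(a, b)"] by (rule sqrt_sum_squares_le_sum) auto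
  show thesis
  proof (rule that[of "e / 4"])
    fix a b a' b'
    assume "dist a p < e / 4" "dist b q < e / 4" "dist a' p' < e / 4" "dist b' q' < e / 4"
    then have "dist ((a, b), (a', b')) ((p, q), (p', q')) < e"
      using tri2[of a b a' b'] tri[of a b p q] tri[of a' b' p' q'] by linarith
    then have "((a, b), (a', b')) \<in> ball ((p, q), (p', q')) e"
      unfolding mem_ball by (subst dist_commute)
    from subsetD[OF e(2) this] show "apart a b a' b'" by simp
  qed (use e(1) in simp)
qed

text \<open>Points are chosen one at a time: the next one has to avoid the earlier points and the
  lines through two of them, a null set that cannot cover a ball.\<close>

lemma general_position:
  fixes f :: "'i \<Rightarrow> real ^ 2"
  assumes "finite I" "0 < \<epsilon>"
  shows "\<exists>g. inj_on g I \<and> (\<forall>i\<in>I. dist (g i) (f i) < \<epsilon>) \<and>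
    (\<forall>i\<in>I. \<forall>j\<in>I. \<forall>l\<in>I. i \<noteq> j \<longrightarrow> i \<noteq> l \<longrightarrow> j \<noteq> l \<longrightarrow> orient (g i) (g j) (g l) \<noteq> 0)"
  using assms(1)
proof induction
  case (insert i F)
  from insert(3) obtain g where g: "inj_on g F" "\<forall>j\<in>F. dist (g j) (f j) < \<epsilon>"
    "\<forall>i\<in>F. \<forall>j\<in>F. \<forall>l\<in>F. i \<noteq> j \<longrightarrow> i \<noteq> l \<longrightarrow> j \<noteq> l \<longrightarrow> orient (g i) (g j) (g l) \<noteq> 0"
    by (elim exE conjE)
  define line where "line = (\<lambda>(j, l). {z. g j \<noteq> g l \<and> orient (g j) (g l) z = 0})"
  have "negligible (line e)" for e
  proof -
    obtain j l where e: "e = (j, l)" by force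
    define m :: "real ^ 2" where "m = vector [- (g l $ 2 - g j $ 2), g l $ 1 - g j $ 1]"
    have "orient (g j) (g l) z = m \<bullet> z - m \<bullet> g j" for z
      unfolding orient_def m_def by (simp add: inner_vec_def sum_2 algebra_simps)
    moreover have "m \<noteq> 0" if "g j \<noteq> g l" using that unfolding m_def by (auto simp: vec_eq_iff forall_2)
    ultimately have "line e \<subseteq> {z. m \<bullet> z = m \<bullet> g j}" "g j \<noteq> g l \<Longrightarrow> m \<noteq> 0" unfolding line_def e by auto
    then show ?thesis
      using negligible_hyperplane[of m "m \<bullet> g j"] negligible_subset
      by (cases "g j = g l") (auto simp: line_def e)
  qed
  then have "negligible (g ` F \<union> \<Union> (line ` (F \<times> F)))"
    using insert(1) by (intro negligible_Un negligible_Union) auto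
  moreover have "\<not> negligible (ball (f i) \<epsilon>)"
    using assms(2) by (intro open_not_negligible) auto
  ultimately have "\<not> ball (f i) \<epsilon> \<subseteq> g ` F \<union> \<Union> (line ` (F \<times> F))"
    using negligible_subset by metis
  then obtain z where "z \<in> ball (f i) \<epsilon>" "z \<notin> g ` F \<union> \<Union> (line ` (F \<times> F))" by (meson subsetI)
  then have z: "z \<in> ball (f i) \<epsilon>" "z \<notin> g ` F" "\<And>e. e \<in> F \<times> F \<Longrightarrow> z \<notin> line e" by auto
  have zo: "orient (g j) (g l) z \<noteq> 0" if "j \<in> F" "l \<in> F" "j \<noteq> l" for j l
    using z(3)[of "(j, l)"] that g(1) unfolding line_def by (auto dest: inj_onD)
  define h where "h = g(i := z)"
  have h: "h i = z" "\<And>j. j \<in> F \<Longrightarrow> h j = g j" unfolding h_def using insert(2) by auto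
  have "h ` F = g ` F" using h(2) by (intro image_cong) auto
  moreover have "inj_on h F" using g(1) h(2) by (simp cong: inj_on_cong)
  ultimately have inj: "inj_on h (insert i F)" using z(2) h(1) insert(2) by simp
  have near: "\<forall>j\<in>insert i F. dist (h j) (f j) < \<epsilon>"
    using g(2) h z(1) by (simp add: dist_commute)
  have "orient (h a) (h b) (h c) \<noteq> 0"
    if abc: "a \<in> insert i F" "b \<in> insert i F" "c \<in> insert i F" "a \<noteq> b" "a \<noteq> c" "b \<noteq> c" for a b c
  proof -
    consider "a = i" "b \<in> F" "c \<in> F" | "b = i" "a \<in> F" "c \<in> F" | "c = i" "a \<in> F" "b \<in> F"
      | "a \<in> F" "b \<in> F" "c \<in> F" using abc by blast
    then show ?thesis
    proof cases
      case 1
      have "orient (h a) (h b) (h c) = orient (h b) (h c) (h a)" unfolding orient_def by (simp add: algebra_simps)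
      then show ?thesis using zo[of b c] abc h 1 by simp
    next
      case 2
      have "orient (h a) (h b) (h c) = - orient (h a) (h c) (h b)" by (rule orient_swap)
      then show ?thesis using zo[of a c] abc h 2 by simp
    next
      case 3
      then show ?thesis using zo[of a b] abc h by simp
    next
      case 4
      then show ?thesis using g(3) abc h(2) by simp
    qed
  qed
  then show ?case using inj near by blast
qed simp

text \<open>Two crossing edges of a path are the end edges of a subpath, so it suffices to look at
  the first and the last edge of every path.\<close>

lemma locally_planeI:
  assumes cross: "\<And>L w. 2 \<le> L \<Longrightarrow> L \<le> l \<Longrightarrow> inj_on w {..L} \<Longrightarrow> (\<And>i. i < L \<Longrightarrow> {w i, w (Suc i)} \<in> E) \<Longrightarrow>
    open_segment (w 0) (w 1) \<inter> open_segment (w (L - 1)) (w L) = {}"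
  shows "locally_plane l V E"
  unfolding locally_plane_def
proof (intro notI, elim exE conjE)
  fix V' E' m
  assume sub: "subgraph V' E' V E" and m: "m \<le> l" and iso: "graph_isomorphic V' E' {0..m} (path_edges m)"
    and si: "self_intersecting E'"
  obtain f where f: "bij_betw f V' {0..m}" "(\<lambda>e. f ` e) ` E' = path_edges m"
    using iso unfolding graph_isomorphic_def by blast
  have E': "\<And>e. e \<in> E' \<Longrightarrow> e \<subseteq> V'" "E' \<subseteq> E"
    using sub unfolding subgraph_def simple_graph_def by auto
  define w where "w = inv_into V' f"
  have w: "inj_on w {0..m}" unfolding w_def using f(1) by (metis bij_betw_def inj_on_inv_into order_refl)
  have wf: "w ` f ` e = e" if "e \<in> E'" for e
    unfolding w_def using f(1) E'(1)[OF that] by (simp add: bij_betw_def inv_into_image_cancel)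
  have edge: "\<exists>i<m. e = {w i, w (Suc i)}" if "e \<in> E'" for e
  proof -
    have "f ` e \<in> path_edges m" using f(2) that by blast
    then obtain i where "i < m" "f ` e = {i, Suc i}" unfolding path_edges_def by blast
    then show ?thesis using wf[OF that] by (intro exI[of _ i]) auto
  qed
  have path: "{w i, w (Suc i)} \<in> E" if "i < m" for i
  proof -
    have "{i, Suc i} \<in> (\<lambda>e. f ` e) ` E'" unfolding f(2) path_edges_def using that by blast
    then obtain e where "e \<in> E'" "f ` e = {i, Suc i}" by auto
    then show ?thesis using wf[of e] E'(2) by auto
  qed
  have key: "open_segment (w i) (w (Suc i)) \<inter> open_segment (w j) (w (Suc j)) = {}" if "i < j" "j < m" for i j
  proof -
    have "inj_on (\<lambda>n. w (i + n)) {..Suc j - i}"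
    proof (rule inj_onI)
      fix n n' assume "n \<in> {..Suc j - i}" "n' \<in> {..Suc j - i}" "w (i + n) = w (i + n')"
      then have "i + n = i + n'" using that by (intro inj_onD[OF w]) auto
      then show "n = n'" by simp
    qed
    then have "open_segment (w (i + 0)) (w (i + 1)) \<inter> open_segment (w (i + (Suc j - i - 1))) (w (i + (Suc j - i))) = {}"
      using that m path by (intro cross[of "Suc j - i" "\<lambda>n. w (i + n)"]) auto
    then show ?thesis using that by simp
  qed
  obtain e e' where e: "e \<in> E'" "e' \<in> E'" "crossing e e'" using si unfolding self_intersecting_def by blast
  obtain i j where ij: "i < m" "e = {w i, w (Suc i)}" "j < m" "e' = {w j, w (Suc j)}"
    using edge e by metis
  have "i \<noteq> j" using e(3) ij unfolding crossing_def by auto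
  then have "open_segment (w i) (w (Suc i)) \<inter> open_segment (w j) (w (Suc j)) = {}"
    using key[of i j] key[of j i] ij by (cases "i < j") auto
  moreover obtain x y u v where xy: "e = {x, y}" "e' = {u, v}" "open_segment x y \<inter> open_segment u v \<noteq> {}"
    using e(3) unfolding crossing_def by blast
  moreover have "open_segment x y = open_segment (w i) (w (Suc i))"
    using xy(1) ij(2) open_segment_commute by (metis doubleton_eq_iff)
  moreover have "open_segment u v = open_segment (w j) (w (Suc j))"
    using xy(2) ij(4) open_segment_commute by (metis doubleton_eq_iff)
  ultimately show False by simp
qed

section \<open>Drawing a coloured graph near two given points\<close>

definition place :: "real ^ 2 \<Rightarrow> real ^ 2 \<Rightarrow> real \<Rightarrow> real \<Rightarrow> real ^ 2" where
  "place p w u t = p + u *\<^sub>R w + t *\<^sub>R vector [- (w $ 2), w $ 1]"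

text \<open>\<open>w\<close> and its rotation by a right angle are orthogonal and equally long, so
  passing to the coordinates \<open>u\<close> and \<open>t\<close> only scales orientations by
  \<open>w \<bullet> w\<close>.\<close>

lemma orient_place:
  "orient (place p w u t) (place p w u' t') (place p w u'' t'') =
     (w \<bullet> w) * ((u' - u) * (t'' - t) - (t' - t) * (u'' - u))"
  unfolding orient_def place_def by (simp add: inner_vec_def sum_2 algebra_simps)

lemma dist_place: "dist (place p w (s + u) t) (p + s *\<^sub>R w) \<le> (\<bar>u\<bar> + \<bar>t\<bar>) * norm w"
proof -
  have "norm (vector [- (w $ 2), w $ 1] :: real ^ 2) = norm w"
    unfolding norm_vec_def L2_set_def by (simp add: sum_2 add.commute)
  moreover have "place p w (s + u) t - (p + s *\<^sub>R w) = u *\<^sub>R w + t *\<^sub>R vector [- (w $ 2), w $ 1]"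
    unfolding place_def by (simp add: algebra_simps)
  ultimately show ?thesis
    unfolding dist_norm using norm_triangle_ineq[of "u *\<^sub>R w" "t *\<^sub>R vector [- (w $ 2), w $ 1]"]
    by (simp add: distrib_right)
qed

lemma bit_sum_bounds:
  assumes "\<And>i. i < D \<Longrightarrow> 0 \<le> f i"
  shows "0 \<le> bit_sum f D x" "bit_sum f D x \<le> (\<Sum>i<D. f i)"
  unfolding bit_sum_def using assms by (auto intro!: sum_nonneg sum_mono)

lemma uniform_positive:
  fixes r :: real
  assumes "finite Q" "0 < r" and ex: "\<And>z. z \<in> Q \<Longrightarrow> \<exists>\<epsilon>>0. P z \<epsilon>"
    and mono: "\<And>z \<epsilon> \<epsilon>'. P z \<epsilon> \<Longrightarrow> \<epsilon>' \<le> \<epsilon> \<Longrightarrow> P z \<epsilon>'"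
  obtains \<epsilon> where "0 < \<epsilon>" "\<epsilon> \<le> r" "\<And>z. z \<in> Q \<Longrightarrow> P z \<epsilon>"
proof -
  from ex obtain f where f: "\<And>z. z \<in> Q \<Longrightarrow> 0 < f z \<and> P z (f z)" by metis
  define \<epsilon> where "\<epsilon> = Min (insert r (f ` Q))"
  have "0 < \<epsilon>" unfolding \<epsilon>_def using assms(1,2) f by (subst Min_gr_iff) auto
  moreover have "\<epsilon> \<le> r" unfolding \<epsilon>_def using assms(1) by (intro Min_le) auto
  moreover have "P z \<epsilon>" if "z \<in> Q" for z
  proof (rule mono)
    show "P z (f z)" using f that by blast
    show "\<epsilon> \<le> f z" unfolding \<epsilon>_def using assms(1) that by (intro Min_le) auto
  qed
  ultimately show thesis using that by blast
qed

text \<open>The ideal position of a vertex, determined by its side and its string. Copies of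
  different old vertices may coincide here; a later perturbation separates them.\<close>

definition base :: "real ^ 2 \<Rightarrow> real ^ 2 \<Rightarrow> nat \<Rightarrow> (nat \<Rightarrow> real) \<Rightarrow> (nat \<Rightarrow> real) \<Rightarrow> bool \<Rightarrow> nat \<Rightarrow> real ^ 2" where
  "base p w D \<alpha> \<beta> left x = place p w ((if left then 0 else 1) + bit_sum \<alpha> D x) (bit_sum \<beta> D x)"

lemma orient_base:
  assumes "even (x div 2 ^ c)" "c < D"
  shows "orient (base p w D \<alpha> \<beta> True x) (base p w D \<alpha> \<beta> False (x + 2 ^ c)) (base p w D \<alpha> \<beta> True z) =
      (w \<bullet> w) * side D \<alpha> \<beta> c x z"
    and "orient (base p w D \<alpha> \<beta> True x) (base p w D \<alpha> \<beta> False (x + 2 ^ c)) (base p w D \<alpha> \<beta> False z) =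
      (w \<bullet> w) * side D \<alpha> \<beta> c (x + 2 ^ c) z"
  unfolding base_def orient_place side_def bit_sum_add[OF assms] by (simp_all add: algebra_simps)

lemma apart_base:
  assumes "even (x div 2 ^ c)" "c < D" "even (x' div 2 ^ c')" "c' < D" "w \<noteq> 0"
    and "sided D \<alpha> \<beta> c x (x + 2 ^ c) c' x' (x' + 2 ^ c')"
  shows "apart (base p w D \<alpha> \<beta> True x) (base p w D \<alpha> \<beta> False (x + 2 ^ c))
    (base p w D \<alpha> \<beta> True x') (base p w D \<alpha> \<beta> False (x' + 2 ^ c'))"
proof -
  have "0 < (w \<bullet> w * a) * (w \<bullet> w * b)" if "0 < a * b" for a b :: real
  proof -
    have "(w \<bullet> w * a) * (w \<bullet> w * b) = (w \<bullet> w)\<^sup>2 * (a * b)" by (simp add: power2_eq_square)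
    moreover have "0 < (w \<bullet> w)\<^sup>2 * (a * b)"
      using assms(5) by (intro mult_pos_pos[OF _ that] zero_less_power) auto
    ultimately show ?thesis by (simp only:)
  qed
  then show ?thesis
    using assms(6) unfolding apart_def sided_def orient_base[OF assms(1,2)] orient_base[OF assms(3,4)] by blast
qed

lemma dist_base:
  assumes "scales D \<alpha> \<beta>" "(\<Sum>i<D. \<alpha> i) \<le> \<delta>" "(\<Sum>i<D. \<beta> i) \<le> \<delta>"
  shows "dist (base p w D \<alpha> \<beta> left x) (if left then p else p + w) \<le> 2 * \<delta> * norm w"
proof -
  have "\<bar>bit_sum \<alpha> D x\<bar> + \<bar>bit_sum \<beta> D x\<bar> \<le> 2 * \<delta>"
    using bit_sum_bounds[of D \<alpha> x] bit_sum_bounds[of D \<beta> x] assms unfolding scales_def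
    by (simp add: less_imp_le)
  then have "(\<bar>bit_sum \<alpha> D x\<bar> + \<bar>bit_sum \<beta> D x\<bar>) * norm w \<le> 2 * \<delta> * norm w"
    by (intro mult_right_mono) auto
  moreover have "dist (base p w D \<alpha> \<beta> left x) (p + (if left then 0 else 1) *\<^sub>R w) \<le>
      (\<bar>bit_sum \<alpha> D x\<bar> + \<bar>bit_sum \<beta> D x\<bar>) * norm w"
    unfolding base_def by (rule dist_place)
  moreover have eq: "p + (if left then 0 else 1) *\<^sub>R w = (if left then p else p + w)" by simp
  ultimately show ?thesis unfolding eq by linarith
qed

text \<open>A vertex is a triple of side, string and old vertex. By properness of the colouring, two
  equal consecutive colours would lead the path back to the vertex it came from.\<close>

lemma path_walk:
  assumes g: "coloured_graph A B D E"
    and inj: "inj_on u {..L}"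
    and step: "\<And>i. i < L \<Longrightarrow> \<exists>l r c x. (l, r, c) \<in> E \<and> even (x div 2 ^ c) \<and>
      {u i, u (Suc i)} = {(True, x, l), (False, x + 2 ^ c, r)}"
  obtains b c where "flips b L (\<lambda>i. fst (snd (u i))) c" "walk E b L (\<lambda>i. snd (snd (u i))) c"
    "\<forall>i<L. (fst (u i) \<longleftrightarrow> even (i + b)) \<and> (fst (u (Suc i)) \<longleftrightarrow> odd (i + b))"
proof -
  have "\<exists>l r c x. (l, r, c) \<in> E \<and> even (x div 2 ^ c) \<and>
      (u i = (True, x, l) \<and> u (Suc i) = (False, x + 2 ^ c, r) \<or>
       u (Suc i) = (True, x, l) \<and> u i = (False, x + 2 ^ c, r))" if "i < L" for i
    using step[OF that] by (simp only: doubleton_eq_iff) blast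
  then obtain c where c: "\<And>i. i < L \<Longrightarrow> \<exists>l r x. (l, r, c i) \<in> E \<and> even (x div 2 ^ c i) \<and>
      (u i = (True, x, l) \<and> u (Suc i) = (False, x + 2 ^ c i, r) \<or>
       u (Suc i) = (True, x, l) \<and> u i = (False, x + 2 ^ c i, r))"
    by metis
  define x where "x i = fst (snd (u i))" for i
  define v where "v i = snd (snd (u i))" for i
  define b where "b = (if fst (u 0) then 0 else 1 :: nat)"
  have par: "fst (u i) \<longleftrightarrow> even (i + b)" if "i \<le> L" for i
    using that
  proof (induction i)
    case (Suc i)
    then show ?case using c[of i] by auto
  qed (auto simp: b_def)
  have cs: "if even (i + b) then u i = (True, x i, v i) \<and> u (Suc i) = (False, x i + 2 ^ c i, v (Suc i)) \<and>
        (v i, v (Suc i), c i) \<in> E \<and> even (x i div 2 ^ c i) \<and> x (Suc i) = x i + 2 ^ c i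
      else u (Suc i) = (True, x (Suc i), v (Suc i)) \<and> u i = (False, x (Suc i) + 2 ^ c i, v i) \<and>
        (v (Suc i), v i, c i) \<in> E \<and> even (x (Suc i) div 2 ^ c i) \<and> x i = x (Suc i) + 2 ^ c i"
    if "i < L" for i
    using c[OF that] par[of i] that unfolding x_def v_def by auto
  have f: "flips b L x c" unfolding flips_def using cs by meson
  have "c i \<noteq> c (Suc i)" if i: "Suc i < L" for i
  proof
    assume eq: "c i = c (Suc i)"
    have "x i = x (Suc (Suc i))"
      using f i eq unfolding flips_def by (metis Suc_lessD add_Suc even_Suc add_right_cancel)
    moreover have "v i = v (Suc (Suc i))"
    proof (cases "even (i + b)")
      case True
      then have "(v i, v (Suc i), c i) \<in> E" "(v (Suc (Suc i)), v (Suc i), c i) \<in> E"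
        using cs[of i] cs[of "Suc i"] i eq by auto
      then show ?thesis using g unfolding coloured_graph_def by blast
    next
      case False
      then have "(v (Suc i), v i, c i) \<in> E" "(v (Suc i), v (Suc (Suc i)), c i) \<in> E"
        using cs[of i] cs[of "Suc i"] i eq by auto
      then show ?thesis using g unfolding coloured_graph_def by blast
    qed
    moreover have "fst (u i) = fst (u (Suc (Suc i)))" using par[of i] par[of "Suc (Suc i)"] i by simp
    ultimately have "u i = u (Suc (Suc i))" unfolding x_def v_def by (simp add: prod_eq_iff)
    then show False using inj_onD[OF inj, of i "Suc (Suc i)"] i by simp
  qed
  then have w: "walk E b L v c" unfolding walk_def using cs by meson
  show thesis
  proof (rule that)
    show "flips b L (\<lambda>i. fst (snd (u i))) c" using f unfolding x_def .
    show "walk E b L (\<lambda>i. snd (snd (u i))) c" using w unfolding v_def .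
    show "\<forall>i<L. (fst (u i) \<longleftrightarrow> even (i + b)) \<and> (fst (u (Suc i)) \<longleftrightarrow> odd (i + b))"
    proof (intro allI impI conjI)
      fix i assume "i < L"
      then show "fst (u i) \<longleftrightarrow> even (i + b)" "fst (u (Suc i)) \<longleftrightarrow> odd (i + b)"
        using par[of i] par[of "Suc i"] by simp_all
    qed
  qed
qed

text \<open>In ideal position the end edges of every path with 3 to \<open>2 * k + 1\<close> edges
  are \<open>apart\<close>. A perturbation small enough to preserve this and generic enough to leave
  no three vertices collinear gives the drawing. \<open>locally_plane\<close> is stated for all
  \<open>V\<close> because isolated vertices are added later.\<close>

lemma geometric_realisation:
  fixes E :: "('a \<times> 'a \<times> nat) set" and p q :: "real ^ 2"
  assumes g: "coloured_graph A B D E" and d: "distinct_runs k E" and free: "pincer_free k E"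
    and pq: "p \<noteq> q" and r: "0 < r"
  obtains V F where "geometric_graph V F" "\<And>V. locally_plane (2 * k + 1) V F"
    "card V = 2 ^ D * (card A + card B)" "card F * 2 = 2 ^ D * card E"
    "\<And>e. e \<in> F \<Longrightarrow> \<exists>x\<in>ball p r. \<exists>y\<in>ball q r. e = {x, y}"
proof -
  have E: "E \<subseteq> A \<times> B \<times> {..<D}" "finite A" "finite B"
    using g unfolding coloured_graph_def by simp_all
  define w where "w = q - p"
  have w: "w \<noteq> 0" "0 < norm w" "p + w = q" using pq unfolding w_def by auto
  \<comment> \<open>This choice turns the bound \<open>2 * \<delta> * norm w\<close> of
    \<open>dist_base\<close> into \<open>r / 2\<close>; the other half of the radius is left for the
    perturbation.\<close>
  obtain \<alpha> \<beta> where s: "scales D \<alpha> \<beta>" "(\<Sum>i<D. \<alpha> i) \<le> r / (4 * norm w)" "(\<Sum>i<D. \<beta> i) \<le> r / (4 * norm w)"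
    using scales_exist[of "r / (4 * norm w)"] r w by auto
  define f where "f = (\<lambda>(left, x, v :: 'a). base p w D \<alpha> \<beta> left x)"
  define I :: "(bool \<times> nat \<times> 'a) set" where "I = {True} \<times> {..<2 ^ D} \<times> A \<union> {False} \<times> {..<2 ^ D} \<times> B"
  have finI: "finite I" unfolding I_def using E by simp
  have cardI: "card I = 2 ^ D * (card A + card B)"
    unfolding I_def using E by (subst card_Un_disjoint) (auto simp: card_cartesian_product distrib_left)
  have near: "dist (f i) (if fst i then p else q) \<le> r / 2" for i
  proof -
    have "dist (f i) (if fst i then p else p + w) \<le> 2 * (r / (4 * norm w)) * norm w"
      using dist_base[OF s, of p w "fst i" "fst (snd i)"] unfolding f_def by (simp only: case_prod_beta)
    moreover have "2 * (r / (4 * norm w)) * norm w = r / 2" using w(2) by simp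
    ultimately show ?thesis by (simp only: w(3))
  qed
  define Q where "Q = {(i, j, i', j') \<in> I \<times> I \<times> I \<times> I. apart (f i) (f j) (f i') (f j')}"
  have "finite Q" using finI by (intro finite_subset[of Q "I \<times> I \<times> I \<times> I"]) (auto simp: Q_def)
  then obtain \<epsilon> where eps: "0 < \<epsilon>" "\<epsilon> \<le> r / 2"
    and stab: "\<And>z. z \<in> Q \<Longrightarrow> (\<lambda>(i, j, i', j') \<epsilon>. \<forall>a b a' b'. dist a (f i) < \<epsilon> \<longrightarrow> dist b (f j) < \<epsilon> \<longrightarrow>
      dist a' (f i') < \<epsilon> \<longrightarrow> dist b' (f j') < \<epsilon> \<longrightarrow> apart a b a' b') z \<epsilon>"
  proof (rule uniform_positive)
    show "0 < r / 2" using r by simp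
    fix z assume "z \<in> Q"
    then obtain i j i' j' where z: "z = (i, j, i', j')" "apart (f i) (f j) (f i') (f j')"
      unfolding Q_def by auto
    from apart_stable[OF z(2)] obtain e where "0 < e" "\<And>a b a' b'. dist a (f i) < e \<Longrightarrow> dist b (f j) < e \<Longrightarrow>
      dist a' (f i') < e \<Longrightarrow> dist b' (f j') < e \<Longrightarrow> apart a b a' b'" by blast
    then show "\<exists>\<epsilon>>0. (\<lambda>(i, j, i', j') \<epsilon>. \<forall>a b a' b'. dist a (f i) < \<epsilon> \<longrightarrow> dist b (f j) < \<epsilon> \<longrightarrow>
      dist a' (f i') < \<epsilon> \<longrightarrow> dist b' (f j') < \<epsilon> \<longrightarrow> apart a b a' b') z \<epsilon>"
      unfolding z(1) by (intro exI[of _ e]) simp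
  qed (auto split: prod.splits)
  from general_position[OF finI eps(1), of f] obtain h where h: "inj_on h I" "\<forall>i\<in>I. dist (h i) (f i) < \<epsilon>"
    "\<forall>i\<in>I. \<forall>j\<in>I. \<forall>l\<in>I. i \<noteq> j \<longrightarrow> i \<noteq> l \<longrightarrow> j \<noteq> l \<longrightarrow> orient (h i) (h j) (h l) \<noteq> 0"
    by (elim exE conjE)
  have stable: "apart (h i) (h j) (h i') (h j')"
    if "apart (f i) (f j) (f i') (f j')" "i \<in> I" "j \<in> I" "i' \<in> I" "j' \<in> I" for i j i' j'
    using stab[of "(i, j, i', j')"] that h(2) unfolding Q_def by simp
  have ball: "h i \<in> ball (if fst i then p else q) r" if "i \<in> I" for i
    using near[of i] h(2) that eps(2) dist_triangle[of "h i" "if fst i then p else q" "f i"]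
    by (auto simp: dist_commute)
  define P where "P = (SIGMA e:E. {y::nat. y < 2 ^ D \<and> even (y div 2 ^ snd (snd e))})"
  define \<phi> where "\<phi> = (\<lambda>((l :: 'a, r :: 'a, c), x). {h (True, x, l), h (False, x + 2 ^ c, r)})"
  define F where "F = \<phi> ` P"
  have edge: "\<exists>l r c x. e = {h (True, x, l), h (False, x + 2 ^ c, r)} \<and> (l, r, c) \<in> E \<and> c < D \<and> even (x div 2 ^ c) \<and>
      (True, x, l) \<in> I \<and> (False, x + 2 ^ c, r) \<in> I" if "e \<in> F" for e
  proof -
    from that obtain l r c x where "e = {h (True, x, l), h (False, x + 2 ^ c, r)}" "(l, r, c) \<in> E"
      "x < 2 ^ D" "even (x div 2 ^ c)" unfolding F_def P_def \<phi>_def by auto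
    moreover from this have "l \<in> A" "r \<in> B" "c < D" using E by auto
    moreover from calculation have "x + 2 ^ c < 2 ^ D" using flip_bound by blast
    ultimately show ?thesis unfolding I_def by blast
  qed
  have "inj_on \<phi> P"
  proof (rule inj_onI)
    fix z z' assume z: "z \<in> P" "z' \<in> P" "\<phi> z = \<phi> z'"
    obtain l r c x l' r' c' x' where zz: "z = ((l, r, c), x)" "z' = ((l', r', c'), x')" by (metis prod.exhaust)
    have "(l, r, c) \<in> E" "x < 2 ^ D" "even (x div 2 ^ c)" "(l', r', c') \<in> E" "x' < 2 ^ D" "even (x' div 2 ^ c')"
      using z zz unfolding P_def by auto
    moreover from this have "x + 2 ^ c < 2 ^ D" "x' + 2 ^ c' < 2 ^ D" using E by (auto intro!: flip_bound)
    ultimately have I: "(True, x, l) \<in> I" "(False, x + 2 ^ c, r) \<in> I" "(True, x', l') \<in> I" "(False, x' + 2 ^ c', r') \<in> I"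
      using E unfolding I_def by auto
    have "{h (True, x, l), h (False, x + 2 ^ c, r)} = {h (True, x', l'), h (False, x' + 2 ^ c', r')}"
      using z(3) unfolding \<phi>_def zz by simp
    then have "(True, x, l) = (True, x', l') \<and> (False, x + 2 ^ c, r) = (False, x' + 2 ^ c', r')"
      using I inj_onD[OF h(1)] unfolding doubleton_eq_iff by (metis prod.inject)
    then have *: "x = x'" "l = l'" "r = r'" "x + 2 ^ c = x' + 2 ^ c'"
      by (auto simp only: prod.inject)
    from *(1,4) have "(2::nat) ^ c = 2 ^ c'" by linarith
    then show "z = z'" unfolding zz using *(1,2,3) by simp
  qed
  then have "card F = card P" unfolding F_def by (rule card_image)
  moreover have "card P * 2 = 2 ^ D * card E"
    unfolding P_def using E by (intro card_flip_pairs finite_subset[OF E(1)]) auto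
  ultimately have cardF: "card F * 2 = 2 ^ D * card E" by simp
  have sub: "e \<subseteq> h ` I" if "e \<in> F" for e using edge[OF that] by auto
  have "geometric_graph (h ` I) F"
    unfolding geometric_graph_def simple_graph_def
  proof (intro conjI ballI allI impI)
    show "finite (h ` I)" using finI by simp
    show "e \<subseteq> h ` I" if "e \<in> F" for e using sub[OF that] .
    show "card e = 2" if "e \<in> F" for e
      using edge[OF that] inj_onD[OF h(1)] by (metis card_2_iff prod.inject)
    fix x y v assume e: "{x, y} \<in> F" and v: "v \<in> h ` I" "v \<in> closed_segment x y"
    obtain i j where ij: "i \<in> I" "j \<in> I" "i \<noteq> j" "{x, y} = {h i, h j}"
      using edge[OF e] by (metis prod.inject)
    obtain l where l: "l \<in> I" "v = h l" using v(1) by blast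
    have "v \<in> closed_segment (h i) (h j)"
      using v(2) ij(4) by (metis closed_segment_commute doubleton_eq_iff)
    then have "orient (h i) (h j) (h l) = 0" using orient_closed_segment l by simp
    then have "l = i \<or> l = j" using h(3) ij l by metis
    then show "v = x \<or> v = y" using ij(4) l by (metis doubleton_eq_iff)
  qed
  moreover have "locally_plane (2 * k + 1) V F" for V
  proof (rule locally_planeI)
    fix L and z :: "nat \<Rightarrow> real ^ 2"
    assume L: "2 \<le> L" "L \<le> 2 * k + 1" and inj: "inj_on z {..L}"
      and path: "\<And>i. i < L \<Longrightarrow> {z i, z (Suc i)} \<in> F"
    define u where "u i = inv_into I h (z i)" for i
    have zI: "z i \<in> h ` I" if "i \<le> L" for i
    proof (cases "i < L")
      case True
      then show ?thesis using sub[OF path[OF True]] by simp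
    next
      case False
      then have "i = Suc (L - 1)" "L - 1 < L" using that L by auto
      then show ?thesis using sub[OF path[of "L - 1"]] by simp
    qed
    have u: "u i \<in> I" "h (u i) = z i" if "i \<le> L" for i
      using zI[OF that] unfolding u_def by (simp_all add: inv_into_into f_inv_into_f)
    have step: "\<exists>l r c x. (l, r, c) \<in> E \<and> even (x div 2 ^ c) \<and>
      {u i, u (Suc i)} = {(True, x, l), (False, x + 2 ^ c, r)}" if i: "i < L" for i
    proof -
      obtain l r c x where lr: "{z i, z (Suc i)} = {h (True, x, l), h (False, x + 2 ^ c, r)}"
        "(l, r, c) \<in> E" "even (x div 2 ^ c)" "(True, x, l) \<in> I" "(False, x + 2 ^ c, r) \<in> I"
        using edge[OF path[OF i]] by blast
      have "h ` {u i, u (Suc i)} = h ` {(True, x, l), (False, x + 2 ^ c, r)}"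
        using lr(1) u[of i] u[of "Suc i"] i by simp
      then have "{u i, u (Suc i)} = {(True, x, l), (False, x + 2 ^ c, r)}"
        using inj_on_image_eq_iff[OF h(1), of "{u i, u (Suc i)}" "{(True, x, l), (False, x + 2 ^ c, r)}"]
          lr(4,5) u[of i] u[of "Suc i"] i by simp
      then show ?thesis using lr(2,3) by blast
    qed
    have inju: "inj_on u {..L}"
      using inj u(2) by (metis (mono_tags, lifting) atMost_iff inj_on_def)
    obtain b c where f: "flips b L (\<lambda>i. fst (snd (u i))) c" and wk: "walk E b L (\<lambda>i. snd (snd (u i))) c"
      and par: "\<forall>i<L. (fst (u i) \<longleftrightarrow> even (i + b)) \<and> (fst (u (Suc i)) \<longleftrightarrow> odd (i + b))"
      by (rule path_walk[OF g inju step])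
    define x where "x i = fst (snd (u i))" for i
    show "open_segment (z 0) (z 1) \<inter> open_segment (z (L - 1)) (z L) = {}"
    proof (cases "L = 2")
      case True
      \<comment> \<open>The two edges share an end and could only overlap if the three vertices were
        collinear.\<close>
      have "u 0 \<noteq> u 1" "u 0 \<noteq> u 2" "u 1 \<noteq> u 2"
        by (simp_all add: inj_on_eq_iff[OF inju] True)
      moreover have "u 0 \<in> I" "u 1 \<in> I" "u 2 \<in> I" using u(1) True by simp_all
      ultimately have "orient (h (u 0)) (h (u 1)) (h (u 2)) \<noteq> 0" using h(3) by metis
      then show ?thesis
        using open_segment_disjoint_common_end u(2)[of 0] u(2)[of 1] u(2)[of 2] True by simp
    next
      case False
      have cD: "c n < D" if "n < L" for n
        using wk that E unfolding walk_def by (auto split: if_splits)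
      have fx: "flips b L x c" using f unfolding x_def .
      have sd: "sided D \<alpha> \<beta> (c 0) (lft b x 0) (rgt b x 0) (c (L - 1)) (lft b x (L - 1)) (rgt b x (L - 1))"
        using walk_sided[OF s(1) fx wk d free _ L(2) cD] L False by simp
      have ends: "\<exists>l r. (True, lft b x n, l) \<in> I \<and> (False, rgt b x n, r) \<in> I \<and>
          open_segment (z n) (z (Suc n)) = open_segment (h (True, lft b x n, l)) (h (False, rgt b x n, r))"
        if n: "n < L" for n
      proof (cases "even (n + b)")
        case True
        then have "u n = (True, lft b x n, snd (snd (u n)))" "u (Suc n) = (False, rgt b x n, snd (snd (u (Suc n))))"
          using par n unfolding lft_def rgt_def x_def by (simp_all add: prod_eq_iff)
        then show ?thesis using u[of n] u[of "Suc n"] n by (metis Suc_leI less_imp_le_nat)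
      next
        case False
        then have "u (Suc n) = (True, lft b x n, snd (snd (u (Suc n))))" "u n = (False, rgt b x n, snd (snd (u n)))"
          using par n unfolding lft_def rgt_def x_def by (simp_all add: prod_eq_iff)
        then show ?thesis using u[of n] u[of "Suc n"] n by (metis Suc_leI less_imp_le_nat open_segment_commute)
      qed
      have flip: "even (lft b x n div 2 ^ c n)" "rgt b x n = lft b x n + 2 ^ c n" if "n < L" for n
        using fx that unfolding flips_def lft_def rgt_def by (auto split: if_splits)
      obtain l r where lr: "(True, lft b x 0, l) \<in> I" "(False, rgt b x 0, r) \<in> I"
        "open_segment (z 0) (z (Suc 0)) = open_segment (h (True, lft b x 0, l)) (h (False, rgt b x 0, r))"
        using ends[of 0] L by auto
      obtain l' r' where lr': "(True, lft b x (L - 1), l') \<in> I" "(False, rgt b x (L - 1), r') \<in> I"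
        "open_segment (z (L - 1)) (z (Suc (L - 1))) = open_segment (h (True, lft b x (L - 1), l')) (h (False, rgt b x (L - 1), r'))"
        using ends[of "L - 1"] L by auto
      have "apart (f (True, lft b x 0, l)) (f (False, rgt b x 0, r))
          (f (True, lft b x (L - 1), l')) (f (False, rgt b x (L - 1), r'))"
        unfolding f_def using apart_base[OF flip(1) cD flip(1) cD w(1)] sd flip(2) L by simp
      then have "apart (h (True, lft b x 0, l)) (h (False, rgt b x 0, r))
          (h (True, lft b x (L - 1), l')) (h (False, rgt b x (L - 1), r'))"
        using stable lr(1,2) lr'(1,2) by blast
      from apart_disjoint[OF this] have "open_segment (z 0) (z (Suc 0)) \<inter> open_segment (z (L - 1)) (z (Suc (L - 1))) = {}"
        by (simp only: lr(3) lr'(3))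
      then show ?thesis using L by simp
    qed
  qed
  moreover have "card (h ` I) = 2 ^ D * (card A + card B)" using card_image[OF h(1)] cardI by simp
  moreover have "\<exists>x\<in>ball p r. \<exists>y\<in>ball q r. e = {x, y}" if "e \<in> F" for e
    using edge[OF that] ball by (metis fst_conv)
  ultimately show thesis using that cardF by blast
qed

section \<open>Counting edges\<close>

text \<open>Points outside the convex hull of \<open>V\<close> lie on no edge.\<close>

lemma add_isolated_vertices:
  assumes g: "geometric_graph V F"
  obtains V' where "geometric_graph V' F" "card V' = card V + j"
proof -
  have fin: "finite V" and F: "\<And>e. e \<in> F \<Longrightarrow> e \<subseteq> V \<and> card e = 2"
    using g unfolding geometric_graph_def simple_graph_def by auto
  have "bounded (convex hull V)" using fin by (simp add: bounded_convex_hull finite_imp_bounded)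
  then have "infinite (UNIV - convex hull V)"
    using bounded_Un[of "convex hull V" "UNIV - convex hull V"] finite_imp_bounded not_bounded_UNIV
    by (metis Un_Diff_cancel sup_top_right)
  then obtain J where J: "finite J" "card J = j" "J \<subseteq> UNIV - convex hull V"
    using infinite_arbitrarily_large by blast
  have "V \<subseteq> convex hull V" by (rule hull_subset)
  then have "V \<inter> J = {}" using J(3) by blast
  then have "card (V \<union> J) = card V + j" using fin J by (simp add: card_Un_disjoint)
  moreover have "geometric_graph (V \<union> J) F"
    unfolding geometric_graph_def simple_graph_def
  proof (intro conjI ballI allI impI)
    fix x y v assume e: "{x, y} \<in> F" and v: "v \<in> V \<union> J" "v \<in> closed_segment x y"
    have "x \<in> V" "y \<in> V" using F[OF e] by auto
    then have "closed_segment x y \<subseteq> convex hull V"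
      unfolding segment_convex_hull by (intro hull_mono) auto
    then have "v \<in> V" using v J(3) by blast
    then show "v = x \<or> v = y" using g e v(2) unfolding geometric_graph_def by blast
  qed (use fin J F in auto)
  ultimately show thesis using that by blast
qed

lemma le_tower: "d \<le> tower k d"
proof (induction k)
  case (Suc k)
  have "tower k d \<le> 4 ^ tower k d"
    by (intro less_imp_le power_gt_expt) simp
  from order.trans[OF Suc.IH this] show ?case by simp
qed simp

text \<open>The factor 4 reproduces itself: the logarithm of \<open>4 ^ Suc e\<close> is
  \<open>2 * (e + 1)\<close>, at most \<open>4 * e\<close>. The lower bound on \<open>u\<close>
  keeps the iterates positive, where the logarithm is monotone.\<close>

lemma iterated_log_le:
  assumes "1 \<le> d" "real (tower k 1) \<le> u" "u \<le> 4 * real (tower k d)"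
  shows "(log 2 ^^ k) u \<le> 4 * real d"
  using assms(2,3)
proof (induction k arbitrary: u)
  case (Suc k)
  define a where "a = tower k 1"
  define e where "e = tower k d"
  have a1: "1 \<le> a" and e1: "1 \<le> e" using le_tower[of 1 k] le_tower[of d k] assms(1) unfolding a_def e_def by auto
  have log4: "log 2 (4 ^ i) = 2 * real i" for i :: nat
  proof -
    have "(4::real) ^ i = 2 ^ (2 * i)" by (simp add: power_mult)
    then show ?thesis by (simp add: log_pow_cancel)
  qed
  have u: "4 ^ a \<le> u" "u \<le> 4 ^ Suc e" using Suc.prems unfolding a_def e_def by simp_all
  have pos: "0 < u" using u(1) by (rule less_le_trans[rotated]) simp
  have "log 2 (4 ^ a) \<le> log 2 u" using u(1) pos by (subst log_le_cancel_iff) auto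
  moreover have "log 2 u \<le> log 2 (4 ^ Suc e)" using u(2) pos by (subst log_le_cancel_iff) auto
  ultimately have "real a \<le> log 2 u" "log 2 u \<le> 4 * real e" using a1 e1 unfolding log4 by simp_all
  then have "(log 2 ^^ k) (log 2 u) \<le> 4 * real d" unfolding a_def e_def by (rule Suc.IH)
  then show ?case by (simp add: funpow_swap1)
qed simp

text \<open>For the largest \<open>d\<close> with \<open>tower k d \<le> n\<close>, the iterated
  logarithm of \<open>n\<close> is at most \<open>8 * d\<close>. As many blocks as fit are drawn,
  which uses more than half of the \<open>n\<close> vertices, and the rest are isolated.\<close>

lemma dense_locally_plane:
  fixes a b :: "real ^ 2"
  assumes k: "0 < k" and n: "tower k 1 \<le> n" and r: "0 < r" and s: "0 < s"
  shows "\<exists>V E. geometric_graph V E \<and> card V = n \<and> locally_plane (2 * k + 1) V E \<and>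
    real (card E) \<ge> ((log 2 ^^ k) (real n) / 240 ^ k - real k) * real n \<and>
    (\<forall>e\<in>E. \<exists>x\<in>ball a r. \<exists>y\<in>ball b s. e = {x, y})"
proof -
  let ?S = "{d. 1 \<le> d \<and> tower k d \<le> n}"
  have "?S \<subseteq> {..n}" using le_tower order.trans by blast
  then have fin: "finite ?S" by (rule finite_subset) simp
  have ne: "?S \<noteq> {}" using n by blast
  define d where "d = Max ?S"
  have d: "1 \<le> d" "tower k d \<le> n" using Max_in[OF fin ne] unfolding d_def by auto
  have "Suc d \<notin> ?S"
  proof
    assume "Suc d \<in> ?S"
    with fin have "Suc d \<le> d" unfolding d_def by (rule Max_ge)
    then show False by simp
  qed
  then have "n < tower k (Suc d)" by simp
  then have "(log 2 ^^ k) (real n) \<le> 4 * real (Suc d)"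
    using n by (intro iterated_log_le) simp_all
  then have logn: "(log 2 ^^ k) (real n) \<le> 8 * real d" using d(1) by simp
  obtain j where j: "k = Suc j" using k by (cases k) auto
  define D where "D = tower j d"
  obtain m where m: "0 < m" "m * 2 ^ D \<le> tower k d" and graphs: "\<And>N. \<exists>A B E. coloured_graph (A :: nat list set) B D E \<and>
       card A + card B = m * N \<and> card E * 2 ^ k = m * N * d \<and> distinct_runs k E \<and> pincer_free k E"
    using pincer_free_graphs[OF d(1), of j] unfolding D_def j by blast
  \<comment> \<open>Size of a drawn block: each of its \<open>m\<close> vertices has
    \<open>2 ^ D\<close> copies in the plane.\<close>
  define M where "M = m * 2 ^ D"
  define N where "N = n div M"
  have M: "0 < M" "M \<le> n" using m d(2) unfolding M_def by auto
  then have MN: "M * N \<le> n" "n < 2 * (M * N)"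
  proof -
    show "M * N \<le> n" unfolding N_def by (rule times_div_less_eq_dividend)
    have "1 \<le> N" unfolding N_def using M div_le_mono[of M n M] by simp
    then have "M \<le> M * N" by simp
    moreover have "n < M * N + M" unfolding N_def using M(1) by (metis dividend_less_times_div add.commute mult_Suc_right)
    ultimately show "n < 2 * (M * N)" by linarith
  qed
  obtain A B E where g: "coloured_graph (A :: nat list set) B D E" "card A + card B = m * N"
    "card E * 2 ^ k = m * N * d" "distinct_runs k E" "pincer_free k E"
    using graphs by blast
  \<comment> \<open>The disks may be concentric, but the drawing needs distinct centres, so
    \<open>b\<close> is replaced by a nearby point \<open>q\<close> other than
    \<open>a\<close>.\<close>
  have "\<not> ball b (s / 2) \<subseteq> {a}"
  proof
    assume "ball b (s / 2) \<subseteq> {a}"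
    moreover have "b \<in> ball b (s / 2)" using s by simp
    ultimately have "ball b (s / 2) = {a}" by blast
    then show False using open_ball not_open_singleton by metis
  qed
  then obtain q where q: "q \<in> ball b (s / 2)" "a \<noteq> q" by blast
  obtain V F where VF: "geometric_graph V F" "\<And>V. locally_plane (2 * k + 1) V F"
    "card V = 2 ^ D * (card A + card B)" "card F * 2 = 2 ^ D * card E"
    "\<And>e. e \<in> F \<Longrightarrow> \<exists>x\<in>ball a (min r (s / 2)). \<exists>y\<in>ball q (min r (s / 2)). e = {x, y}"
    using geometric_realisation[OF g(1,4,5) q(2), of "min r (s / 2)"] r s by auto
  obtain V' where V': "geometric_graph V' F" "card V' = card V + (n - M * N)"
    using add_isolated_vertices[OF VF(1)] by blast
  have "card V = M * N" unfolding VF(3) g(2) M_def by simp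
  then have cardV: "card V' = n" using V'(2) MN by simp
  have "card F * 2 * 2 ^ k = M * N * d"
    unfolding VF(4) M_def using g(3) by (metis mult.assoc mult.commute)
  then have "real (card F * 2 * 2 ^ k) = real (M * N * d)" by (simp only:)
  then have cardF: "real (card F) * 2 ^ Suc k = real (M * N) * real d" by simp
  have "((log 2 ^^ k) (real n) / 240 ^ k - real k) * real n \<le> (8 * real d / 240 ^ k) * real n"
  proof (rule mult_right_mono)
    have "(log 2 ^^ k) (real n) / 240 ^ k \<le> 8 * real d / 240 ^ k"
      using logn by (rule divide_right_mono) simp
    then show "(log 2 ^^ k) (real n) / 240 ^ k - real k \<le> 8 * real d / 240 ^ k" by simp
  qed simp
  \<comment> \<open>The density of the drawn part is \<open>d / 2 ^ Suc k\<close>, and filling up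
    costs at most another factor 2. Together with the factor 8 from the logarithm this asks for
    \<open>32 * 2 ^ k \<le> 240 ^ k\<close>.\<close>
  also have "\<dots> \<le> (real d / 2 ^ Suc (Suc k)) * real n"
  proof -
    have "(120::real) ^ 1 \<le> 120 ^ k" using k by (intro power_increasing) auto
    then have "32 * 2 ^ k \<le> (120 ^ k * 2 ^ k :: real)" by (intro mult_right_mono) auto
    also have "\<dots> = 240 ^ k" by (simp flip: power_mult_distrib)
    finally have "8 * real d / 240 ^ k \<le> 8 * real d / (32 * 2 ^ k)"
      by (intro divide_left_mono) auto
    then show ?thesis by (intro mult_right_mono) auto
  qed
  also have "\<dots> \<le> (real d / 2 ^ Suc (Suc k)) * (2 * real (M * N))"
    using MN(2) by (intro mult_left_mono) (auto simp del: of_nat_mult)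
  also have "\<dots> = real (card F)"
    using cardF by (simp add: field_simps)
  finally have "((log 2 ^^ k) (real n) / 240 ^ k - real k) * real n \<le> real (card F)" .
  moreover have "\<exists>x\<in>ball a r. \<exists>y\<in>ball b s. e = {x, y}" if "e \<in> F" for e
  proof -
    obtain x y where xy: "x \<in> ball a (min r (s / 2))" "y \<in> ball q (min r (s / 2))" "e = {x, y}"
      using VF(5)[OF \<open>e \<in> F\<close>] by blast
    have "dist b y \<le> dist b q + dist q y" by (rule dist_triangle)
    then have "y \<in> ball b s" using xy(2) q(1) by simp
    moreover have "x \<in> ball a r" using xy(1) by simp
    ultimately show ?thesis using xy(3) by blast
  qed
  ultimately show ?thesis using V'(1) cardV VF(2) by blast
qed

theorem theorem17:
  fixes k :: nat
  assumes "k > 0"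
  shows "\<exists>N::nat. \<forall>n\<ge>N.
    (\<exists>V E. geometric_graph V E \<and> card V = n \<and> locally_plane (2 * k + 1) V E \<and>
       real (card E) \<ge> ((log 2 ^^ k) (real n) / 240 ^ k - real k) * real n) \<and>
    (\<forall>(a :: real^2) (b :: real^2) (r :: real) (s :: real). r > 0 \<longrightarrow> s > 0 \<longrightarrow>
      (\<exists>V E. geometric_graph V E \<and> card V = n \<and> locally_plane (2 * k + 1) V E \<and>
         real (card E) \<ge> ((log 2 ^^ k) (real n) / 240 ^ k - real k) * real n \<and>
         (\<forall>e\<in>E. \<exists>x\<in>ball a r. \<exists>y\<in>ball b s. e = {x, y})))"
\<comment> \<open>From this threshold on there is some \<open>d \<ge> 1\<close> with
  \<open>tower k d \<le> n\<close>.\<close>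
proof (intro exI[of _ "tower k 1"] allI impI conjI)
  fix n assume n: "tower k 1 \<le> n"
  show "\<exists>V E. geometric_graph V E \<and> card V = n \<and> locally_plane (2 * k + 1) V E \<and>
       real (card E) \<ge> ((log 2 ^^ k) (real n) / 240 ^ k - real k) * real n"
    using dense_locally_plane[OF assms n zero_less_one zero_less_one, of 0 0] by blast
  fix a b :: "real ^ 2" and r s :: real
  assume "r > 0" "s > 0"
  then show "\<exists>V E. geometric_graph V E \<and> card V = n \<and> locally_plane (2 * k + 1) V E \<and>
         real (card E) \<ge> ((log 2 ^^ k) (real n) / 240 ^ k - real k) * real n \<and>
         (\<forall>e\<in>E. \<exists>x\<in>ball a r. \<exists>y\<in>ball b s. e = {x, y})"
    using dense_locally_plane[OF assms n] by blast
qed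

end
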